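(* $\mathrm{LWCQSym}[t]=\mathrm{RenQSym}$ as subalgebras of $\mathbf k[[X]][t]$.
   Context: $\mathbf k$ is a commutative ring containing $\mathbb Q$. $\mathbb P$ and $\mathbb N$ denote positive and nonnegative integers. A weak composition is a finite sequence of nonnegative integers, possibly empty; it is left weak if it is empty or its last entry is positive. Let $X=\{x_i:i\in\mathbb P\}$ be commuting indeterminates. For left weak $\alpha$, $M_\alpha=\sum_{0<i_1<\cdots<i_k}x_{i_1}^{\alpha_1}\cdots x_{i_k}^{\alpha_k}$ ($M_\emptyset=1$). $\mathrm{LWCQSym}$ is the $\mathbf k$-span of these. GSym. $\mathrm{GSym}$ is the $\mathbb Q$-span of $\widehat M_{\binom{\gamma}{\mu}}=\sum_{0<i_1<\cdots<i_r}i_1^{\mu_1}\cdots i_r^{\mu_r}x_{i_1}^{\gamma_1}\cdots x_{i_r}^{\gamma_r}$, for $\gamma$ left weak and $\mu\in\mathbb N^r$. Regularization. For $\alpha\in\mathbb N^k$, $\beta\in\mathbb P^k$, $\phi\binom{\alpha}{\beta}\in\mathrm{GSym}[t][z^{-1},z]]$ is obtained from $\sum_{0<i_1<\cdots<i_k}\prod_l x_{i_l}^{\alpha_l}e^{(i_l+t)\beta_lz}$. The coefficient of each $X$-monomial converges absolutely for $t\ge0$, $\mathrm{Re}(z)<0$; it is expanded as a Laurent series in $z$ with coefficients in $\mathbb Q[t]$, and powers are collected. Renormalization. Let $P$ be the polar-part projection in $z$. Set $\phi_-(\emptyset)=1$, and let $E=\phi\binom{\alpha}{\beta}+\sum_{i=1}^{k-1}\phi\binom{\alpha_1..\alpha_i}{\beta_1..\beta_i}\phi_-\binom{\alpha_{i+1}..\alpha_k}{\beta_{i+1}..\beta_k}$.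 Then $\phi_-\binom{\alpha}{\beta}=-P(E)$ and $\phi_+\binom{\alpha}{\beta}=(\mathrm{id}-P)(E)$, and $Z\binom{\alpha}{\beta}=\phi_+\binom{\alpha}{\beta}|_{z=0}$. Renormalized monomial quasisymmetric functions. For any weak composition $\alpha$ of length $k$, $M_\alpha:=Z\binom{\alpha}{\delta,\dots,\delta}$ with $\delta\in\mathbb P$; this does not depend on $\delta$, and it agrees with the series above for left weak $\alpha$. $\mathrm{RenQSym}$ is the $\mathbf k$-span of all $M_\alpha$, $\alpha$ a weak composition, inside $\mathbf k[[X]][t]$. *)

theory Defs
  imports "HOL-Analysis.Analysis" "HOL-Library.Multiset"
    "HOL-Computational_Algebra.Polynomial"
    "HOL-Computational_Algebra.Formal_Laurent_Series"
begin

text \<open>An X-monomial x_{i1}^{a1} x_{i2}^{a2} ... is represented by the multiset of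
  variable indices (index i with multiplicity = exponent of x_i).
  An element of k[[X]][t] (and of k[t][[X]]) is represented by its coefficient
  function  nat multiset => 'k poly  (coefficient in k[t] of each X-monomial).
  A weak composition is a nat list.\<close>

definition left_weak :: "nat list \<Rightarrow> bool" where
  "left_weak \<alpha> \<longleftrightarrow> \<alpha> = [] \<or> last \<alpha> > 0"

definition index_tuples :: "nat \<Rightarrow> nat list set" where
  "index_tuples k = {i. length i = k \<and> sorted_wrt (<) i \<and> (\<forall>j\<in>set i. 0 < j)}"

definition xmono :: "nat list \<Rightarrow> nat list \<Rightarrow> nat multiset" where
  "xmono \<alpha> i = (\<Sum>l<length \<alpha>. replicate_mset (\<alpha> ! l) (i ! l))"

definition M_series :: "nat list \<Rightarrow> nat multiset \<Rightarrow> 'k::comm_ring_1 poly" where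
  "M_series \<alpha> m = of_nat (card {i \<in> index_tuples (length \<alpha>). xmono \<alpha> i = m})"

definition LWCQSym_t :: "(nat multiset \<Rightarrow> 'k::comm_ring_1 poly) set" where
  "LWCQSym_t = {f. \<exists>A c. finite A \<and> (\<forall>\<alpha>\<in>A. left_weak \<alpha>) \<and>
        f = (\<lambda>m. \<Sum>\<alpha>\<in>A. c \<alpha> * M_series \<alpha> m)}"

type_synonym zseries = "nat multiset \<Rightarrow> rat poly fls"

definition zs_one :: zseries where
  "zs_one m = (if m = {#} then 1 else 0)"

definition zs_mult :: "zseries \<Rightarrow> zseries \<Rightarrow> zseries" where
  "zs_mult f g m = (\<Sum>(a, b) \<in> {(a, b). a + b = m}. f a * g b)"

definition polar :: "rat poly fls \<Rightarrow> rat poly fls" where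
  "polar f = f - fps_to_fls (fls_regpart f)"

definition nonpolar :: "rat poly fls \<Rightarrow> rat poly fls" where
  "nonpolar f = fps_to_fls (fls_regpart f)"

text \<open>The analytic function (of real t \<ge> 0 and complex z with Re z < 0) giving the
  coefficient of the X-monomial m in
  sum_{0<i_1<...<i_k} prod_l x_{i_l}^{alpha_l} e^{(i_l + t) beta_l z};
  the argument is the list of pairs (alpha_l, beta_l).\<close>
definition reg_fun :: "(nat \<times> nat) list \<Rightarrow> nat multiset \<Rightarrow> real \<Rightarrow> complex \<Rightarrow> complex" where
  "reg_fun ab m t z =
     infsum (\<lambda>i. \<Prod>l<length ab. exp ((of_nat (i ! l) + of_real t) * of_nat (snd (ab ! l)) * z))
       {i \<in> index_tuples (length ab). xmono (map fst ab) i = m}"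

definition qpoly_eval :: "rat poly \<Rightarrow> real \<Rightarrow> complex" where
  "qpoly_eval p t = complex_of_real (poly (map_poly of_rat p) t)"

text \<open>L is the Laurent expansion in z (coefficients in Q[t]) of F(t,z):
  for every t \<ge> 0 the Laurent series sum_n L_n(t) z^n converges to F(t,z)
  for all z in a punctured disc around 0 with Re z < 0.\<close>
definition is_laurent_exp :: "rat poly fls \<Rightarrow> (real \<Rightarrow> complex \<Rightarrow> complex) \<Rightarrow> bool" where
  "is_laurent_exp L F \<longleftrightarrow>
     (\<forall>t::real. t \<ge> 0 \<longrightarrow> (\<exists>r>0. \<forall>z::complex. z \<noteq> 0 \<and> cmod z < r \<and> Re z < 0 \<longrightarrow>
        (let K = nat (- fls_subdegree L) in
          (\<lambda>n. qpoly_eval (fls_nth L (int n - int K)) t * z ^ n) sums (z ^ K * F t z))))"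

definition phi :: "(nat \<times> nat) list \<Rightarrow> zseries" where
  "phi ab m = (THE L. is_laurent_exp L (reg_fun ab m))"

function phi_minus :: "(nat \<times> nat) list \<Rightarrow> zseries" where
  "phi_minus ab =
     (if ab = [] then zs_one
      else (\<lambda>m. - polar ((\<lambda>m. phi ab m +
          (\<Sum>i\<in>{1..<length ab}. zs_mult (phi (take i ab)) (phi_minus (drop i ab)) m)) m)))"
  by pat_completeness auto
termination
  by (relation "Wellfounded.measure length") auto

definition phi_E :: "(nat \<times> nat) list \<Rightarrow> zseries" where
  "phi_E ab m = phi ab m +
      (\<Sum>i\<in>{1..<length ab}. zs_mult (phi (take i ab)) (phi_minus (drop i ab)) m)"

definition phi_plus :: "(nat \<times> nat) list \<Rightarrow> zseries" where
  "phi_plus ab m = nonpolar (phi_E ab m)"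

definition Zren :: "(nat \<times> nat) list \<Rightarrow> nat multiset \<Rightarrow> rat poly" where
  "Zren ab m = fls_nth (phi_plus ab m) 0"

text \<open>The embedding Q -> k for a commutative ring k containing Q.\<close>
definition rat_to :: "rat \<Rightarrow> 'k::comm_ring_1" where
  "rat_to q = (let (a, b) = quotient_of q in
      of_int a * (THE u. of_int b * u = (1::'k)))"

text \<open>M_alpha := Z(alpha; delta,...,delta), with delta = 1.\<close>
definition M_ren :: "nat list \<Rightarrow> nat multiset \<Rightarrow> 'k::comm_ring_1 poly" where
  "M_ren \<alpha> m = map_poly rat_to (Zren (zip \<alpha> (replicate (length \<alpha>) 1)) m)"

definition RenQSym :: "(nat multiset \<Rightarrow> 'k::comm_ring_1 poly) set" where
  "RenQSym = {f. \<exists>A c. finite A \<and>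
        f = (\<lambda>m. \<Sum>\<alpha>\<in>A. smult (c \<alpha>) (M_ren \<alpha> m))}"

end

theory Submission
  imports Defs "HOL-Complex_Analysis.Laurent_Convergence"
begin

text \<open>Write a weak composition as \<open>\<gamma>\<close> followed by \<open>p\<close> zeros, with \<open>\<gamma>\<close> left weak. Summing over the
  \<open>p\<close> indices above \<open>n\<close> that carry exponent \<open>0\<close> gives, with \<open>s = n + t\<close>,
  \<open>G\<^sub>p(s) = e\<^bsup>(ps + p(p+1)/2)z\<^esup> / \<Prod>\<^bsub>l\<le>p\<^esub> (1 - e\<^bsup>lz\<^esup>)\<close>, and
  \<open>G\<^sub>p(s) - G\<^sub>p(s+1) = e\<^bsup>(s+1)z\<^esup> G\<^bsub>p-1\<^esub>(s+1)\<close>. Convolving with the counterterms of the all-zero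
  compositions preserves this recursion, so by induction on \<open>p\<close> the polar coefficients are
  shift-invariant polynomials in \<open>t\<close>, hence constants. Therefore the same counterterms also
  renormalize every \<open>\<gamma>\<close> followed by zeros, counterterms of compositions that are not all zero vanish,
  and the renormalized function is \<open>\<Sum>\<^sub>i h\<^sub>p(t + i\<^bsub>last\<^esub>) x\<^sub>i\<^bsup>\<gamma>\<^esup>\<close> for polynomials with
  \<open>h\<^sub>p(s) - h\<^sub>p(s+1) = h\<^bsub>p-1\<^esub>(s+1)\<close> and \<open>deg h\<^sub>p = p\<close>.

  Newton's formula expands \<open>h\<^sub>p(t + n)\<close> in the binomials \<open>binom(n-1, j)\<close>, and weighting a left weak
  series by a binomial in its last index is a combination of series with zeros inserted before the
  last entry. The top term is \<open>h\<^sub>p(t+1)\<close> times the series of \<open>\<gamma>\<close>, whose leading coefficient is a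
  unit, so the expansion can be inverted by induction on the degree in \<open>t\<close>.\<close>

section \<open>Laurent series with polynomial coefficients\<close>

text \<open>One interface for all changes of coefficients below: constants into Q[t], substitution
  for t, evaluation at a real t, and \<open>rat_to\<close> from Q into k.\<close>

locale coeff_hom =
  fixes f :: "'a::comm_ring_1 \<Rightarrow> 'b::comm_ring_1"
  assumes hom_add: "f (x + y) = f x + f y"
    and hom_mult: "f (x * y) = f x * f y"
    and hom_one: "f 1 = 1"
begin

lemma hom_zero: "f 0 = 0"
  using hom_add[of 0 0] by simp

lemma hom_uminus: "f (- x) = - f x"
  using hom_add[of x "- x"] by (simp add: hom_zero minus_unique)

lemma hom_diff: "f (x - y) = f x - f y"
  using hom_add[of x "- y"] by (simp add: hom_uminus)

lemma hom_sum: "f (sum g A) = (\<Sum>x\<in>A. f (g x))"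
  by (induction A rule: infinite_finite_induct) (auto simp: hom_zero hom_add)

lemma hom_power: "f (x ^ n) = f x ^ n"
  by (induction n) (auto simp: hom_one hom_mult)

lemma hom_of_nat: "f (of_nat n) = of_nat n"
  by (induction n) (auto simp: hom_zero hom_one hom_add)

end

definition fls_map :: "('a::zero \<Rightarrow> 'b::zero) \<Rightarrow> 'a fls \<Rightarrow> 'b fls" where
  "fls_map f L = Abs_fls (\<lambda>n. f (fls_nth L n))"

lemma fls_map_nth: "f 0 = 0 \<Longrightarrow> fls_nth (fls_map f L) n = f (fls_nth L n)"
  unfolding fls_map_def
  by (rule nth_Abs_fls_lower_bound[of "fls_subdegree L"]) auto

text \<open>Arbitrary lower bounds for the subdegrees let two products be written over one index
  range, so that a product can be compared with its image under a homomorphism.\<close>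

lemma fls_times_nth_bounds:
  fixes F G :: "'a::comm_ring_1 fls"
  assumes "a \<le> fls_subdegree F" "b \<le> fls_subdegree G"
  shows "fls_nth (F * G) n = (\<Sum>i=a..n-b. fls_nth F i * fls_nth G (n - i))"
  unfolding fls_times_nth(2)
  using assms by (intro sum.mono_neutral_left) (auto simp: not_le)

context coeff_hom
begin

lemma fls_map_add: "fls_map f (F + G) = fls_map f F + fls_map f G"
  by (rule fls_eqI) (simp add: fls_map_nth hom_zero hom_add)

lemma fls_map_diff: "fls_map f (F - G) = fls_map f F - fls_map f G"
  by (rule fls_eqI) (simp add: fls_map_nth hom_zero hom_diff)

lemma fls_map_zero: "fls_map f 0 = 0"
  by (rule fls_eqI) (simp add: fls_map_nth hom_zero)

lemma fls_map_one: "fls_map f 1 = 1"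
  by (rule fls_eqI) (simp add: fls_map_nth hom_zero hom_one)

lemma fls_map_mult: "fls_map f (F * G) = fls_map f F * fls_map f G"
proof (rule fls_eqI)
  fix n
  \<comment> \<open>The subdegree may rise when leading coefficients are killed, and may drop to 0
    when the image vanishes; the minimum serves both sides.\<close>
  define a where "a = min (fls_subdegree F) (fls_subdegree (fls_map f F))"
  define b where "b = min (fls_subdegree G) (fls_subdegree (fls_map f G))"
  show "fls_nth (fls_map f (F * G)) n = fls_nth (fls_map f F * fls_map f G) n"
    by (subst fls_map_nth, simp add: hom_zero)
      (simp add: fls_times_nth_bounds[of a _ b] a_def b_def fls_map_nth hom_zero hom_sum hom_mult)
qed

lemma fls_map_sum: "fls_map f (sum G A) = (\<Sum>x\<in>A. fls_map f (G x))"
  by (induction A rule: infinite_finite_induct) (auto simp: fls_map_zero fls_map_add)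

lemma fls_map_prod: "fls_map f (prod G A) = (\<Prod>x\<in>A. fls_map f (G x))"
  by (induction A rule: infinite_finite_induct) (auto simp: fls_map_one fls_map_mult)

end

lemma fls_map_inverse:
  fixes f :: "'a::field \<Rightarrow> 'b::field"
  assumes "coeff_hom f"
  shows "fls_map f (inverse F) = inverse (fls_map f F)"
proof (cases "F = 0")
  case True
  then show ?thesis by (simp add: coeff_hom.fls_map_zero[OF assms])
next
  case False
  then have "fls_map f (inverse F) * fls_map f F = 1"
    by (simp flip: coeff_hom.fls_map_mult[OF assms] add: coeff_hom.fls_map_one[OF assms])
  then show ?thesis by (metis inverse_unique mult.commute)
qed

section \<open>Exponential series over Q[t] and the generating function of trailing zeros\<close>

definition poly_exp :: "rat poly \<Rightarrow> rat poly fls" where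
  "poly_exp c = fps_to_fls (Abs_fps (\<lambda>n. smult (1 / fact n) (c ^ n)))"

lemma poly_exp_nth: "fls_nth (poly_exp c) n = (if n < 0 then 0 else smult (1 / fact (nat n)) (c ^ nat n))"
  by (simp add: poly_exp_def)

lemma poly_exp_0: "poly_exp 0 = 1"
  by (rule fls_eqI) (simp add: poly_exp_nth power_0_left)

lemma smult_sum_right: "smult c (sum g A) = (\<Sum>x\<in>A. smult c (g x))"
  by (induction A rule: infinite_finite_induct) (auto simp: smult_add_right)

lemma poly_exp_add: "poly_exp (a + b) = poly_exp a * poly_exp b"
proof -
  have "Abs_fps (\<lambda>n. smult (1 / fact n) ((a + b) ^ n)) =
     Abs_fps (\<lambda>n. smult (1 / fact n) (a ^ n)) * Abs_fps (\<lambda>n. smult (1 / fact n) (b ^ n))"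
  proof (rule fps_ext)
    fix n
    have "smult (1 / fact n) ((a + b) ^ n) =
        (\<Sum>i\<le>n. smult (1 / fact n) (of_nat (n choose i) * a ^ i * b ^ (n - i)))"
      by (simp add: binomial_ring smult_sum_right)
    also have "\<dots> = (\<Sum>i=0..n. smult (1 / fact i) (a ^ i) * smult (1 / fact (n - i)) (b ^ (n - i)))"
      unfolding atMost_atLeast0
    proof (rule sum.cong)
      fix i assume "i \<in> {0..n}"
      then have "of_nat (n choose i) / fact n = (1 / fact i * (1 / fact (n - i)) :: rat)"
        by (simp add: binomial_fact field_simps)
      moreover have "smult (1 / fact n) (of_nat (n choose i) * a ^ i * b ^ (n - i)) =
          smult (of_nat (n choose i) / fact n) (a ^ i * b ^ (n - i))"
        by (simp add: of_nat_poly)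
      ultimately show "smult (1 / fact n) (of_nat (n choose i) * a ^ i * b ^ (n - i)) =
          smult (1 / fact i) (a ^ i) * smult (1 / fact (n - i)) (b ^ (n - i))"
        by (simp add: mult.commute)
    qed simp
    finally show "Abs_fps (\<lambda>n. smult (1 / fact n) ((a + b) ^ n)) $ n =
       (Abs_fps (\<lambda>n. smult (1 / fact n) (a ^ n)) * Abs_fps (\<lambda>n. smult (1 / fact n) (b ^ n))) $ n"
      by (simp add: fps_mult_nth)
  qed
  then show ?thesis
    unfolding poly_exp_def by (simp add: fls_times_fps_to_fls)
qed

lemma coeff_hom_const: "coeff_hom (\<lambda>q::rat. [:q:])"
  by unfold_locales auto

lemma coeff_hom_pcompose: "coeff_hom (\<lambda>q::rat poly. pcompose q s)"
  by unfold_locales (auto simp: pcompose_add pcompose_mult pcompose_1)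

abbreviation shift_poly :: "rat \<Rightarrow> rat poly" where
  "shift_poly a \<equiv> [:a, 1:]"

lemma fls_map_pcompose_poly_exp: "fls_map (\<lambda>q. pcompose q s) (poly_exp c) = poly_exp (pcompose c s)"
  by (rule fls_eqI) (simp add: fls_map_nth poly_exp_nth pcompose_smult 
    coeff_hom.hom_power[OF coeff_hom_pcompose])

definition q_prod :: "nat \<Rightarrow> 'a::field_char_0 fls" where
  "q_prod p = (\<Prod>l=1..p. 1 - fps_to_fls (fps_exp (of_nat l)))"

lemma q_prod_nonzero: "q_prod p \<noteq> (0 :: 'a::field_char_0 fls)"
proof -
  have "1 - fps_to_fls (fps_exp (of_nat l)) \<noteq> (0 :: 'a fls)" if "l \<ge> 1" for l
  proof
    assume "1 - fps_to_fls (fps_exp (of_nat l)) = (0 :: 'a fls)"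
    then have "fls_nth (1 - fps_to_fls (fps_exp (of_nat l :: 'a))) 1 = 0" by simp
    with that show False by simp
  qed
  then show ?thesis unfolding q_prod_def by auto
qed

text \<open>The function \<open>G\<^sub>p(s)\<close>. The product is inverted over the field Q and
  only then embedded into Q[t], which is not a field.\<close>

definition zero_gf :: "nat \<Rightarrow> rat poly \<Rightarrow> rat poly fls" where
  "zero_gf p s = poly_exp (of_nat p * s + of_nat (\<Sum>{..p})) *
     fls_map (\<lambda>q. [:q:]) (inverse (q_prod p))"

lemma zero_gf_0: "zero_gf 0 s = 1"
  by (simp add: zero_gf_def q_prod_def poly_exp_0 coeff_hom.fls_map_one[OF coeff_hom_const])

lemma fls_map_const_exp: "fls_map (\<lambda>q. [:q:]) (fps_to_fls (fps_exp (of_nat l))) = poly_exp (of_nat l)"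
  by (rule fls_eqI) (simp add: fls_map_nth poly_exp_nth of_nat_poly 
    flip: coeff_hom.hom_power[OF coeff_hom_const])

text \<open>Combinatorially, the tuples above n are split by whether their first entry is n + 1.
  Formally, all three terms share the factor e^{ez} with \<open>e\<close> the exponent at s; passing
  to s + 1 multiplies by e^{(p+1)z}, and the difference is the denominator factor 1 - e^{(p+1)z},
  which cancels.\<close>

lemma zero_gf_rec:
  "zero_gf (Suc p) s = zero_gf (Suc p) (s + 1) + poly_exp (s + 1) * zero_gf p (s + 1)"
proof -
  define D where "D n = fls_map (\<lambda>q::rat. [:q:]) (inverse (q_prod n))" for n
  have "q_prod (Suc p) = q_prod p * (1 - fps_to_fls (fps_exp (of_nat (Suc p) :: rat)))"
    by (simp add: q_prod_def)
  then have "inverse (q_prod p :: rat fls) =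
      inverse (q_prod (Suc p)) * (1 - fps_to_fls (fps_exp (of_nat (Suc p))))"
    using q_prod_nonzero[of p, where 'a = rat] q_prod_nonzero[of "Suc p", where 'a = rat]
    by (auto simp: field_simps)
  then have D: "D p = D (Suc p) * (1 - poly_exp (of_nat (Suc p)))"
    unfolding D_def by (simp only: coeff_hom.fls_map_mult[OF coeff_hom_const]
      coeff_hom.fls_map_diff[OF coeff_hom_const] coeff_hom.fls_map_one[OF coeff_hom_const]
      fls_map_const_exp)
  define e where "e = of_nat (Suc p) * s + of_nat (\<Sum>{..Suc p})"
  have 1: "of_nat (Suc p) * (s + 1) + of_nat (\<Sum>{..Suc p}) = e + of_nat (Suc p)"
    by (simp add: e_def algebra_simps)
  have 2: "(s + 1) + (of_nat p * (s + 1) + of_nat (\<Sum>{..p})) = e"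
    by (simp add: e_def algebra_simps)
  have "poly_exp (s + 1) * zero_gf p (s + 1) = poly_exp e * D p"
    unfolding zero_gf_def D_def 2[symmetric] by (simp add: poly_exp_add mult.assoc)
  moreover have "zero_gf (Suc p) (s + 1) = poly_exp e * poly_exp (of_nat (Suc p)) * D (Suc p)"
    unfolding zero_gf_def D_def 1 by (simp only: poly_exp_add)
  moreover have "zero_gf (Suc p) s = poly_exp e * D (Suc p)"
    unfolding zero_gf_def D_def e_def ..
  ultimately show ?thesis by (simp add: D algebra_simps)
qed

text \<open>The denominator has constant coefficients, so substituting for t only changes the
  exponent.\<close>

lemma zero_gf_pcompose: "fls_map (\<lambda>q. pcompose q s) (zero_gf p u) = zero_gf p (pcompose u s)"
proof -
  have "fls_map (\<lambda>q. pcompose q s) (fls_map (\<lambda>q. [:q:]) L) = fls_map (\<lambda>q. [:q:]) L" for L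
    by (rule fls_eqI) (simp add: fls_map_nth)
  then show ?thesis
    unfolding zero_gf_def
    by (simp add: coeff_hom.fls_map_mult[OF coeff_hom_pcompose] fls_map_pcompose_poly_exp 
       pcompose_add pcompose_mult coeff_hom.hom_of_nat[OF coeff_hom_pcompose] del: of_nat_sum)
qed

section \<open>Counterterms and regularity of the renormalized generating function\<close>

fun counterterm :: "nat \<Rightarrow> rat poly fls" where
  "counterterm p = (if p = 0 then 1 
     else - polar (\<Sum>j<p. zero_gf (p - j) (shift_poly 0) * counterterm j))"

declare counterterm.simps [simp del]

lemma counterterm_0: "counterterm 0 = 1"
  by (simp add: counterterm.simps)

text \<open>The counterterms are computed at s = t, while the other factor is moved to s. The term j
  = p is \<open>counterterm p\<close> itself, so for p > 0 and s = t this is the sum in the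
  recursion of \<open>counterterm\<close> minus its polar part.\<close>

definition ren_gf :: "nat \<Rightarrow> rat poly \<Rightarrow> rat poly fls" where
  "ren_gf p s = (\<Sum>j\<le>p. zero_gf (p - j) s * counterterm j)"

lemma ren_gf_0: "ren_gf 0 s = 1"
  by (simp add: ren_gf_def zero_gf_0 counterterm_0)

lemma polar_nth: "fls_nth (polar f) n = (if n < 0 then fls_nth f n else 0)"
  by (simp add: polar_def)

lemma nonpolar_nth: "fls_nth (nonpolar f) n = (if n < 0 then 0 else fls_nth f n)"
  by (simp add: nonpolar_def)

text \<open>The recursion of \<open>zero_gf\<close> is applied term by term; the last term is a
  counterterm, free of s, and cancels in the difference.\<close>

lemma ren_gf_Suc_diff:
  "ren_gf (Suc p) s - ren_gf (Suc p) (s + 1) = poly_exp (s + 1) * ren_gf p (s + 1)"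
proof -
  have "ren_gf (Suc p) s - ren_gf (Suc p) (s + 1) =
      (\<Sum>j\<le>p. (zero_gf (Suc p - j) s - zero_gf (Suc p - j) (s + 1)) * counterterm j)"
    by (simp add: ren_gf_def zero_gf_0 sum_subtractf[symmetric] left_diff_distrib)
  also have "\<dots> = (\<Sum>j\<le>p. poly_exp (s + 1) * zero_gf (p - j) (s + 1) * counterterm j)"
  proof (rule sum.cong)
    fix j assume "j \<in> {..p}"
    then have "Suc p - j = Suc (p - j)" by auto
    then show "(zero_gf (Suc p - j) s - zero_gf (Suc p - j) (s + 1)) * counterterm j =
         poly_exp (s + 1) * zero_gf (p - j) (s + 1) * counterterm j"
      using zero_gf_rec[of "p - j" s] by simp
  qed simp
  finally show ?thesis by (simp add: ren_gf_def sum_distrib_left mult.assoc)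
qed

text \<open>Such an f takes the value f(0) at every natural number, so f - f(0) has infinitely many
  roots.\<close>

lemma pcompose_shift_fixed_imp_const:
  fixes f :: "rat poly"
  assumes "pcompose f (shift_poly 1) = f"
  shows "\<exists>c. f = [:c:]"
proof -
  have step: "poly f (1 + x) = poly f x" for x
    using assms by (metis poly_pcompose poly_pCons mult_1_right poly_0 mult_zero_right add_0_right)
  have "poly f (of_nat n) = poly f 0" for n
    by (induction n) (simp_all add: step)
  then have "range (of_nat :: nat \<Rightarrow> rat) \<subseteq> {x. poly (f - [:poly f 0:]) x = 0}"
    by auto
  moreover have "infinite (range (of_nat :: nat \<Rightarrow> rat))"
    by (rule range_inj_infinite) (rule inj_of_nat)
  ultimately have "infinite {x. poly (f - [:poly f 0:]) x = 0}"
    using finite_subset by blast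
  then have "f - [:poly f 0:] = 0"
    using poly_roots_finite by blast
  then show ?thesis by (metis eq_iff_diff_eq_0)
qed

lemma fls_regular_mult:
  fixes F G :: "'a::comm_ring_1 fls"
  assumes "\<And>n. n < 0 \<Longrightarrow> fls_nth F n = 0" "\<And>n. n < 0 \<Longrightarrow> fls_nth G n = 0"
  shows "n < 0 \<Longrightarrow> fls_nth (F * G) n = 0"
    and "fls_nth (F * G) 0 = fls_nth F 0 * fls_nth G 0"
proof -
  have 0: "0 \<le> fls_subdegree F" "0 \<le> fls_subdegree G"
    using assms by (force intro: fls_subdegree_geI simp: not_le fls_subdegree_ge0I)+
  show "n < 0 \<Longrightarrow> fls_nth (F * G) n = 0"
    by (simp add: fls_times_nth_bounds[OF 0])
  show "fls_nth (F * G) 0 = fls_nth F 0 * fls_nth G 0"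
    by (simp add: fls_times_nth_bounds[OF 0])
qed

text \<open>Both claims go through one induction. Constancy in t is expressed as invariance under
  every substitution. With constant earlier counterterms, \<open>U\<close> commutes with
  substitution, and U(t) - U(t+1) is an exponential times \<open>ren_gf\<close> of the predecessor,
  hence regular. So the polar coefficients of U(t) are shift-invariant and therefore
  constant.\<close>

lemma counterterm_const_ren_gf_regular:
  "(\<forall>s. fls_map (\<lambda>q. pcompose q s) (counterterm p) = counterterm p) \<and>
   (\<forall>s. \<forall>n<0. fls_nth (ren_gf p s) n = 0)"
proof (induction p rule: less_induct)
  case (less p)
  show ?case
  proof (cases p)
    case 0
    then show ?thesis
      by (simp add: counterterm_0 ren_gf_0 coeff_hom.fls_map_one[OF coeff_hom_pcompose])
  next
    case (Suc r)
    let ?X = "shift_poly 0"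
    \<comment> \<open>The term j = p is left out, so that only counterterms covered by the induction
      hypothesis occur.\<close>
    define U where "U s = (\<Sum>j<p. zero_gf (p - j) s * counterterm j)" for s
    have C: "counterterm p = - polar (U ?X)"
      using Suc by (subst counterterm.simps) (simp add: U_def)
    have H: "ren_gf p s = U s + counterterm p" for s
      by (simp add: ren_gf_def U_def zero_gf_0 flip: lessThan_Suc_atMost)
    have U: "U s = fls_map (\<lambda>q. pcompose q s) (U ?X)" for s
      using less by (simp add: U_def coeff_hom.fls_map_sum[OF coeff_hom_pcompose]
        coeff_hom.fls_map_mult[OF coeff_hom_pcompose] zero_gf_pcompose pcompose_pCons)
    have const: "\<exists>c. fls_nth (U ?X) n = [:c:]" if "n < 0" for n
    proof (rule pcompose_shift_fixed_imp_const)
      have "U ?X - U (?X + 1) = poly_exp (?X + 1) * ren_gf r (?X + 1)"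
        using ren_gf_Suc_diff[of r ?X] H Suc by simp
      moreover have "fls_nth (poly_exp (?X + 1) * ren_gf r (?X + 1)) n = 0"
        by (rule fls_regular_mult(1)) (use less[of r] Suc that in \<open>auto simp: poly_exp_nth\<close>)
      ultimately have "fls_nth (U ?X) n = fls_nth (U (shift_poly 1)) n"
        by (metis add_pCons add.left_neutral add_0_right fls_minus_nth right_minus_eq one_pCons)
      then show "pcompose (fls_nth (U ?X) n) (shift_poly 1) = fls_nth (U ?X) n"
        by (subst (asm) (2) U) (simp add: fls_map_nth)
    qed
    have inv: "fls_map (\<lambda>q. pcompose q s) (counterterm p) = counterterm p" for s
    proof (rule fls_eqI)
      fix n
      show "fls_nth (fls_map (\<lambda>q. pcompose q s) (counterterm p)) n = fls_nth (counterterm p) n"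
        using const[of n] by (auto simp: C fls_map_nth polar_nth pcompose_uminus)
    qed
    have "fls_nth (ren_gf p s) n = 0" if "n < 0" for n s
    proof -
      \<comment> \<open>A constant polar coefficient is unchanged by substitution, so the
        counterterm computed at s = t removes the pole at every s.\<close>
      from const[OF that] obtain c where c: "fls_nth (U ?X) n = [:c:]" by blast
      have "fls_nth (U s) n = [:c:]" by (subst U) (simp add: fls_map_nth c)
      with c that show ?thesis by (simp add: H C polar_nth)
    qed
    with inv show ?thesis by blast
  qed
qed

lemmas counterterm_const = counterterm_const_ren_gf_regular[THEN conjunct1, rule_format]
  and ren_gf_regular = counterterm_const_ren_gf_regular[THEN conjunct2, rule_format]

lemma ren_gf_pcompose: "ren_gf p (pcompose u s) = fls_map (\<lambda>q. pcompose q s) (ren_gf p u)"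
  by (simp add: ren_gf_def coeff_hom.fls_map_sum[OF coeff_hom_pcompose]
        coeff_hom.fls_map_mult[OF coeff_hom_pcompose] zero_gf_pcompose counterterm_const)

section \<open>The polynomials \<open>h\<^sub>p\<close>: difference equation, Newton expansion,
  degree\<close>

definition ren_poly :: "nat \<Rightarrow> rat poly" where
  "ren_poly p = fls_nth (ren_gf p (shift_poly 0)) 0"

lemma ren_gf_nth_0: "fls_nth (ren_gf p s) 0 = pcompose (ren_poly p) s"
  using ren_gf_pcompose[of p "shift_poly 0" s]
  by (simp add: ren_poly_def fls_map_nth pcompose_pCons)

lemma ren_poly_0: "ren_poly 0 = 1"
  by (simp add: ren_poly_def ren_gf_0)

text \<open>Take constant terms in z of the recursion for \<open>ren_gf\<close>: both factors on the
  right are regular and the exponential has constant term 1.\<close>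

lemma ren_poly_rec:
  "pcompose (ren_poly (Suc p)) s = pcompose (ren_poly (Suc p)) (s + 1) + pcompose (ren_poly p) (s + 1)"
proof -
  have "fls_nth (ren_gf (Suc p) s - ren_gf (Suc p) (s + 1)) 0 =
     fls_nth (poly_exp (s + 1) * ren_gf p (s + 1)) 0"
    by (simp only: ren_gf_Suc_diff)
  also have "\<dots> = pcompose (ren_poly p) (s + 1)"
    by (subst fls_regular_mult(2)) (auto simp: poly_exp_nth ren_gf_regular ren_gf_nth_0)
  finally show ?thesis by (simp add: ren_gf_nth_0 algebra_simps)
qed

text \<open>By \<open>ren_poly_rec\<close> the forward difference of h_p at s is -h_{p-1}(s+1), so
  the j-th difference is (-1)^j h_{p-j}(s+j) and this is Newton's forward formula. The induction on
  n uses Pascal's rule.\<close>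

lemma ren_poly_newton:
  "pcompose (ren_poly p) (s + of_nat n) =
    (\<Sum>j\<le>p. (-1) ^ j * of_nat (n choose j) * pcompose (ren_poly (p - j)) (s + of_nat j))"
proof (induction n arbitrary: s p)
  case 0
  have "(\<Sum>j\<le>p. (-1) ^ j * of_nat (0 choose j) * pcompose (ren_poly (p - j)) (s + of_nat j)) =
      (\<Sum>j\<in>{0}. (-1) ^ j * of_nat (0 choose j) * pcompose (ren_poly (p - j)) (s + of_nat j))"
    by (rule sum.mono_neutral_right) (auto simp: binomial_eq_0)
  then show ?case by simp
next
  case (Suc n)
  let ?h = "\<lambda>p s. pcompose (ren_poly p) s"
  show ?case
  proof (cases p)
    case 0
    then show ?thesis by (simp add: ren_poly_0 pcompose_1)
  next
    case (Suc r)
    have "?h p (s + of_nat (Suc n)) = ?h p (s + of_nat n) - ?h r (s + 1 + of_nat n)"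
      using ren_poly_rec[of r "s + of_nat n"] Suc by (simp add: algebra_simps)
    also have "\<dots> = (\<Sum>j\<le>Suc r. (-1) ^ j * of_nat (n choose j) * ?h (Suc r - j) (s + of_nat j)) -
       (\<Sum>j\<le>r. (-1) ^ j * of_nat (n choose j) * ?h (r - j) (s + of_nat (Suc j)))"
      unfolding Suc.IH Suc by (simp add: algebra_simps)
    also have "\<dots> = (\<Sum>j\<le>Suc r. (-1) ^ j * of_nat (Suc n choose j) * ?h (Suc r - j) (s + of_nat j))"
      unfolding sum.atMost_Suc_shift
      by (simp add: algebra_simps sum.distrib sum_negf sum_subtractf)
    finally show ?thesis using Suc by simp
  qed
qed

lemma pcompose_shift_diff:
  fixes f :: "rat poly"
  assumes "degree f \<le> Suc d"
  shows "degree (pcompose f (shift_poly 1) - f) \<le> d \<and>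
    coeff (pcompose f (shift_poly 1) - f) d = of_nat (Suc d) * coeff f (Suc d)"
  using assms
proof (induction d arbitrary: f)
  case 0
  obtain a g where f: "f = pCons a g" by (cases f)
  with 0 have "degree g = 0" by (auto split: if_splits)
  then obtain b where "g = [:b:]" by (metis degree_0_id)
  with f show ?case by (auto simp: pcompose_pCons)
next
  case (Suc d)
  obtain a g where f: "f = pCons a g" by (cases f)
  with Suc.prems have g: "degree g \<le> Suc d" by (auto split: if_splits)
  define D where "D = pcompose g (shift_poly 1) - g"
  from Suc.IH[OF g] have D: "degree D \<le> d" "coeff D d = of_nat (Suc d) * coeff g (Suc d)"
    by (auto simp: D_def)
  \<comment> \<open>With f = a + t g, f(t+1) - f(t) = (t+1) g(t+1) - t g(t), and g(t+1) = g +
    D.\<close>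
  have eq: "pcompose f (shift_poly 1) - f = g + D + pCons 0 D"
    by (simp add: f pcompose_pCons D_def algebra_simps)
  have "degree (g + D + pCons 0 D) \<le> Suc d"
    using g D by (intro degree_add_le) (auto intro: le_trans[OF degree_pCons_le])
  moreover have "coeff (g + D + pCons 0 D) (Suc d) = of_nat (Suc (Suc d)) * coeff f (Suc (Suc d))"
    using D by (simp add: f coeff_eq_0 algebra_simps)
  ultimately show ?case by (simp add: eq)
qed

text \<open>The difference of h_{p+1} is -h_p(t+1), nonzero of degree p; in characteristic 0 the
  difference of a nonconstant polynomial has degree exactly one less.\<close>

lemma degree_ren_poly: "degree (ren_poly p) = p \<and> ren_poly p \<noteq> 0"
proof (induction p)
  case 0
  then show ?case by (simp add: ren_poly_0)
next
  case (Suc p)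
  let ?X = "shift_poly 0"
  have "?X + 1 = shift_poly 1" by (simp add: one_pCons)
  then have eq: "pcompose (ren_poly (Suc p)) (shift_poly 1) - ren_poly (Suc p) =
      - pcompose (ren_poly p) (shift_poly 1)"
    using ren_poly_rec[of p ?X] by (simp add: pcompose_idR)
  have deg: "degree (pcompose (ren_poly p) (shift_poly 1)) = p"
    using Suc by (simp add: degree_pcompose)
  have nz: "pcompose (ren_poly p) (shift_poly 1) \<noteq> 0"
    using Suc by (simp add: pcompose_eq_0_iff)
  show ?case
  proof (cases "degree (ren_poly (Suc p))")
    case 0
    then obtain c where "ren_poly (Suc p) = [:c:]" by (metis degree_0_id)
    then show ?thesis using eq nz by simp
  next
    case (Suc d)
    then have "degree (- pcompose (ren_poly p) (shift_poly 1)) \<le> d"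
      "coeff (- pcompose (ren_poly p) (shift_poly 1)) d = of_nat (Suc d) * coeff (ren_poly (Suc p)) (Suc d)"
      using pcompose_shift_diff[of "ren_poly (Suc p)" d] eq by auto
    moreover have "coeff (ren_poly (Suc p)) (Suc d) \<noteq> 0"
      using Suc by (metis Zero_not_Suc degree_0 leading_coeff_0_iff)
    ultimately have "degree (- pcompose (ren_poly p) (shift_poly 1)) = d"
      by (metis antisym le_degree mult_eq_0_iff of_nat_eq_0_iff old.nat.distinct(2))
    with deg have "d = p" by simp
    with Suc show ?thesis by auto
  qed
qed

section \<open>Laurent expansions and sums over increasing tuples\<close>

lemma coeff_hom_map_poly:
  assumes "coeff_hom f"
  shows "coeff_hom (map_poly f)"
proof -
  interpret coeff_hom f by fact
  show ?thesis
  proof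
    show "map_poly f (p + q) = map_poly f p + map_poly f q" for p q
      by (rule poly_eqI) (simp add: coeff_map_poly hom_zero hom_add)
    show "map_poly f (p * q) = map_poly f p * map_poly f q" for p q
      by (rule poly_eqI) (simp add: coeff_map_poly hom_zero hom_sum hom_mult coeff_mult)
    show "map_poly f 1 = 1"
      by (simp add: hom_one map_poly_1')
  qed
qed

lemma coeff_hom_qpoly_eval: "coeff_hom (\<lambda>p. qpoly_eval p t)"
proof -
  have "coeff_hom (of_rat :: rat \<Rightarrow> real)"
    by unfold_locales (auto simp: of_rat_add of_rat_mult)
  then interpret coeff_hom "map_poly (of_rat :: rat \<Rightarrow> real)"
    by (rule coeff_hom_map_poly)
  show ?thesis
    by unfold_locales (auto simp: qpoly_eval_def hom_add hom_mult hom_one)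
qed

lemma qpoly_eval_const: "qpoly_eval [:q:] t = of_rat q"
  by (cases q) (simp add: qpoly_eval_def map_poly_pCons of_rat_rat)

lemma qpoly_eval_X: "qpoly_eval (shift_poly 0) t = of_real t"
  by (simp add: qpoly_eval_def map_poly_pCons)

section \<open>Uniqueness and construction of Laurent expansions\<close>

lemma qpoly_eval_inject:
  assumes "\<And>t. t \<ge> 0 \<Longrightarrow> qpoly_eval p t = qpoly_eval q t"
  shows "p = q"
proof -
  define r where "r = map_poly (of_rat :: rat \<Rightarrow> real) p - map_poly of_rat q"
  have "{0..} \<subseteq> {t. poly r t = 0}"
    using assms by (auto simp: r_def qpoly_eval_def)
  moreover have "infinite {0::real..}"
    by (simp add: infinite_Ici)
  ultimately have "infinite {t. poly r t = 0}"
    using finite_subset by blast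
  then have "r = 0" using poly_roots_finite by blast
  then have "coeff (map_poly (of_rat :: rat \<Rightarrow> real) p) n = coeff (map_poly of_rat q) n" for n
    by (simp add: r_def)
  then show ?thesis
    by (intro poly_eqI) (simp add: coeff_map_poly)
qed

text \<open>Expansions are controlled only for Re z < 0. Convergence at -r/2 gives a positive
  radius, and a nonzero series cannot vanish at negative reals accumulating at 0.\<close>

lemma powser_zero_on_neg_reals:
  fixes a :: "nat \<Rightarrow> complex"
  assumes "r > 0"
    and zero: "\<And>x. 0 < x \<Longrightarrow> x < r \<Longrightarrow> (\<lambda>n. a n * (- of_real x) ^ n) sums 0"
  shows "a n = 0"
proof -
  define P where "P = Abs_fps a"
  have "summable (\<lambda>n. a n * (- of_real (r / 2)) ^ n)"
    using zero[of "r / 2"] \<open>r > 0\<close> by (auto simp: sums_iff)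
  then have "conv_radius a \<ge> norm (- complex_of_real (r / 2))"
    by (rule conv_radius_geI)
  moreover have "norm (- complex_of_real (r / 2)) = r / 2" using \<open>r > 0\<close> by simp
  ultimately have "conv_radius a \<ge> ereal (r / 2)" by simp
  moreover have "0 < ereal (r / 2)" using \<open>r > 0\<close> by simp
  ultimately have "0 < conv_radius a" by (rule less_le_trans[rotated])
  then have "fps_conv_radius P > 0"
    unfolding P_def fps_conv_radius_def by simp
  then have "eval_fps P has_laurent_expansion fps_to_fls P"
    by (intro has_laurent_expansion_fps) (simp add: has_fps_expansion_def)
  moreover have "\<not> eventually (\<lambda>z. eval_fps P z \<noteq> 0) (at 0)"
  proof
    assume "eventually (\<lambda>z. eval_fps P z \<noteq> 0) (at 0)"
    then obtain d where d: "d > 0" "\<And>z. z \<noteq> 0 \<Longrightarrow> dist z 0 < d \<Longrightarrow> eval_fps P z \<noteq> 0"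
      by (auto simp: eventually_at)
    define x where "x = min d r / 2"
    have x: "0 < x" "x < d" "x < r" using d \<open>r > 0\<close> by (auto simp: x_def)
    have "eval_fps P (- of_real x) = 0"
      using zero[of x] x by (simp add: eval_fps_def P_def sums_iff)
    with d(2)[of "- of_real x"] x show False by simp
  qed
  ultimately have "P = 0"
    using has_laurent_expansion_nonzero_imp_eventually_nonzero fps_to_fls_eq_0_iff by blast
  then show ?thesis by (metis P_def fps_nth_Abs_fps fps_zero_nth)
qed

text \<open>The definition clears the pole with an exponent that depends on L. Any larger exponent N
  also works, since the additional leading coefficients lie below the subdegree; two expansions can
  then be compared with a common N.\<close>

lemma is_laurent_exp_sums:
  assumes "is_laurent_exp L F" "N \<ge> nat (- fls_subdegree L)" "t \<ge> 0"
  obtains r where "r > 0" "\<And>z. z \<noteq> 0 \<Longrightarrow> cmod z < r \<Longrightarrow> Re z < 0 \<Longrightarrow>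
    (\<lambda>n. qpoly_eval (fls_nth L (int n - int N)) t * z ^ n) sums (z ^ N * F t z)"
proof -
  define K where "K = nat (- fls_subdegree L)"
  obtain r where r: "r > 0" "\<And>z. z \<noteq> 0 \<Longrightarrow> cmod z < r \<Longrightarrow> Re z < 0 \<Longrightarrow>
    (\<lambda>n. qpoly_eval (fls_nth L (int n - int K)) t * z ^ n) sums (z ^ K * F t z)"
    using assms by (auto simp: is_laurent_exp_def Let_def K_def)
  have "(\<lambda>n. qpoly_eval (fls_nth L (int n - int N)) t * z ^ n) sums (z ^ N * F t z)"
    if z: "z \<noteq> 0" "cmod z < r" "Re z < 0" for z
  proof -
    define e where "e = N - K"
    have N: "N = e + K" using assms by (simp add: e_def K_def)
    have "(\<lambda>n. z ^ e * (qpoly_eval (fls_nth L (int n - int K)) t * z ^ n)) sums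
        (z ^ e * (z ^ K * F t z))"
      using r(2)[OF z] by (rule sums_mult)
    then have "(\<lambda>n. qpoly_eval (fls_nth L (int (n + e) - int N)) t * z ^ (n + e)) sums (z ^ N * F t z)"
      by (simp add: N power_add mult_ac)
    moreover have "qpoly_eval (fls_nth L (int i - int N)) t * z ^ i = 0" if "i < e" for i
    proof -
      have "int i - int N < fls_subdegree L" using that by (auto simp: N K_def)
      then show ?thesis by (simp add: coeff_hom.hom_zero[OF coeff_hom_qpoly_eval])
    qed
    ultimately show ?thesis
      by (subst (asm) sums_iff_shift) simp
  qed
  with r(1) show ?thesis using that by blast
qed

lemma is_laurent_exp_unique:
  assumes "is_laurent_exp L F" "is_laurent_exp L' F"
  shows "L = L'"
proof (rule fls_eqI)
  fix k
  \<comment> \<open>N clears the poles of both series and also makes the index k + N of the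
    coefficient in question nonnegative.\<close>
  define N where "N = max (nat (- fls_subdegree L)) (max (nat (- fls_subdegree L')) (nat (- k)))"
  have "qpoly_eval (fls_nth L k) t = qpoly_eval (fls_nth L' k) t" if t: "t \<ge> 0" for t
  proof -
    obtain r where r: "r > 0" "\<And>z. z \<noteq> 0 \<Longrightarrow> cmod z < r \<Longrightarrow> Re z < 0 \<Longrightarrow>
      (\<lambda>n. qpoly_eval (fls_nth L (int n - int N)) t * z ^ n) sums (z ^ N * F t z)"
      by (rule is_laurent_exp_sums[OF assms(1), of N t]) (use t in \<open>auto simp: N_def\<close>)
    obtain r' where r': "r' > 0" "\<And>z. z \<noteq> 0 \<Longrightarrow> cmod z < r' \<Longrightarrow> Re z < 0 \<Longrightarrow>
      (\<lambda>n. qpoly_eval (fls_nth L' (int n - int N)) t * z ^ n) sums (z ^ N * F t z)"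
      by (rule is_laurent_exp_sums[OF assms(2), of N t]) (use t in \<open>auto simp: N_def\<close>)
    define d where "d n = qpoly_eval (fls_nth L (int n - int N)) t - qpoly_eval (fls_nth L' (int n - int N)) t" for n
    have "d n = 0" for n
    proof (rule powser_zero_on_neg_reals[of "min r r'"])
      fix x assume x: "0 < x" "x < min r r'"
      have "(\<lambda>n. d n * (- of_real x) ^ n) sums
        ((- of_real x) ^ N * F t (- of_real x) - (- of_real x) ^ N * F t (- of_real x))"
        unfolding d_def left_diff_distrib using x by (intro sums_diff r(2) r'(2)) auto
      then show "(\<lambda>n. d n * (- of_real x) ^ n) sums 0" by simp
    qed (use r r' in auto)
    moreover have "k + int N \<ge> 0" by (auto simp: N_def)
    ultimately show ?thesis
      using d_def[of "nat (k + int N)"] by simp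
  qed
  then show "fls_nth L k = fls_nth L' k" by (rule qpoly_eval_inject)
qed

text \<open>It suffices to find, for each t, a function g with an expansion around the whole of 0
  that agrees with F on the left half-plane. Multiplying by z^K turns the expansion into a power
  series, which converges near 0.\<close>

lemma is_laurent_expI:
  assumes exp: "\<And>t. t \<ge> 0 \<Longrightarrow> g t has_laurent_expansion fls_map (\<lambda>p. qpoly_eval p t) L"
    and eq: "\<And>t z. t \<ge> 0 \<Longrightarrow> Re z < 0 \<Longrightarrow> F t z = g t z"
  shows "is_laurent_exp L F"
  unfolding is_laurent_exp_def Let_def
proof (intro allI impI)
  fix t :: real assume t: "t \<ge> 0"
  note ev0 = coeff_hom.hom_zero[OF coeff_hom_qpoly_eval]
  define K where "K = nat (- fls_subdegree L)"
  define P where "P = Abs_fps (\<lambda>n. qpoly_eval (fls_nth L (int n - int K)) t)"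
  have "fls_shift (- int K) (fls_map (\<lambda>p. qpoly_eval p t) L) = fps_to_fls P"
  proof (rule fls_eqI)
    fix n
    have "n < 0 \<Longrightarrow> n - int K < fls_subdegree L" by (auto simp: K_def)
    then show "fls_nth (fls_shift (- int K) (fls_map (\<lambda>p. qpoly_eval p t) L)) n = fls_nth (fps_to_fls P) n"
      by (simp add: fls_map_nth ev0 P_def)
  qed
  then have "(\<lambda>z. g t z * z powi int K) has_laurent_expansion fps_to_fls P"
    using has_laurent_expansion_shift[OF exp[OF t], of "int K"] by simp
  then have "(\<lambda>z. if z = 0 then fps_nth P 0 else g t z * z powi int K) has_fps_expansion P"
    by (rule has_fps_expansion_fps_to_fls)
  then have rad: "fps_conv_radius P > 0" and
    ev: "eventually (\<lambda>z. eval_fps P z = (if z = 0 then fps_nth P 0 else g t z * z powi int K)) (nhds 0)"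
    by (auto simp: has_fps_expansion_def)
  have "eventually (\<lambda>z. z \<in> eball 0 (fps_conv_radius P)) (nhds (0::complex))"
    using rad by (intro eventually_nhds_in_open) (auto simp: zero_ereal_def)
  with ev have "eventually (\<lambda>z. z \<noteq> 0 \<longrightarrow>
      (\<lambda>n. fps_nth P n * z ^ n) sums (g t z * z powi int K)) (nhds 0)"
  proof eventually_elim
    case (elim z)
    then have "(\<lambda>n. fps_nth P n * z ^ n) sums eval_fps P z"
      by (intro sums_eval_fps) auto
    with elim show ?case by auto
  qed
  then obtain r where r: "r > 0" "\<And>z. cmod z < r \<Longrightarrow> z \<noteq> 0 \<Longrightarrow>
      (\<lambda>n. fps_nth P n * z ^ n) sums (g t z * z powi int K)"
    by (auto simp: eventually_nhds_metric)
  show "\<exists>r>0. \<forall>z. z \<noteq> 0 \<and> cmod z < r \<and> Re z < 0 \<longrightarrow>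
     (\<lambda>n. qpoly_eval (fls_nth L (int n - int (nat (- fls_subdegree L)))) t * z ^ n) sums
       (z ^ nat (- fls_subdegree L) * F t z)"
    using r eq[OF t] by (auto simp: P_def K_def[symmetric] mult.commute intro!: exI[of _ r])
qed

lemma phi_eqI:
  assumes "is_laurent_exp L (reg_fun ab m)"
  shows "phi ab m = L"
  unfolding phi_def using assms is_laurent_exp_unique by blast

lemma fls_map_eval_poly_exp:
  "fls_map (\<lambda>p. qpoly_eval p t) (poly_exp c) = fps_to_fls (fps_exp (qpoly_eval c t))"
proof (rule fls_eqI)
  fix n
  have "qpoly_eval (smult q p) t = of_rat q * qpoly_eval p t" for q p
    using coeff_hom.hom_mult[OF coeff_hom_qpoly_eval, of "[:q:]" p t] by (simp add: qpoly_eval_const)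
  moreover have "of_rat (1 / fact m) = (1 / fact m :: complex)" for m
    by (metis of_nat_fact of_rat_1 of_rat_divide of_rat_of_nat_eq)
  ultimately show "fls_nth (fls_map (\<lambda>p. qpoly_eval p t) (poly_exp c)) n =
      fls_nth (fps_to_fls (fps_exp (qpoly_eval c t))) n"
    by (simp add: fls_map_nth coeff_hom.hom_zero[OF coeff_hom_qpoly_eval] poly_exp_nth
        coeff_hom.hom_power[OF coeff_hom_qpoly_eval])
qed

lemma poly_exp_expansion:
  "(\<lambda>z. exp (qpoly_eval c t * z)) has_laurent_expansion fls_map (\<lambda>p. qpoly_eval p t) (poly_exp c)"
  unfolding fls_map_eval_poly_exp by (intro has_laurent_expansion_fps has_fps_expansion_exp)

lemma coeff_hom_of_rat: "coeff_hom (of_rat :: rat \<Rightarrow> complex)"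
  by unfold_locales (auto simp: of_rat_add of_rat_mult)

text \<open>Embedding constants into Q[t] and evaluating at t amounts to \<open>of_rat\<close>, a
  field homomorphism, which commutes with the inverse.\<close>

lemma q_prod_expansion:
  "(\<lambda>z. inverse (\<Prod>l=1..p. 1 - exp (of_nat l * z))) has_laurent_expansion
    fls_map (\<lambda>q. qpoly_eval q t) (fls_map (\<lambda>q. [:q:]) (inverse (q_prod p)))"
proof -
  have "fls_map (\<lambda>q. qpoly_eval q t) (fls_map (\<lambda>q. [:q:]) (inverse (q_prod p))) =
      fls_map of_rat (inverse (q_prod p))"
    by (rule fls_eqI) (simp add: fls_map_nth coeff_hom.hom_zero[OF coeff_hom_qpoly_eval] qpoly_eval_const)
  also have "\<dots> = inverse (fls_map of_rat (q_prod p))"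
    by (rule fls_map_inverse[OF coeff_hom_of_rat])
  also have "fls_map of_rat (fps_to_fls (fps_exp (of_nat l))) = fps_to_fls (fps_exp (of_nat l :: complex))" for l
  proof (rule fls_eqI)
    fix n
    have "of_rat (of_nat l ^ m / fact m) = (of_nat l ^ m / fact m :: complex)" for m
      by (metis of_nat_fact of_rat_divide of_rat_of_nat_eq of_rat_power)
    then show "fls_nth (fls_map of_rat (fps_to_fls (fps_exp (of_nat l)))) n =
        fls_nth (fps_to_fls (fps_exp (of_nat l :: complex))) n"
      by (simp add: fls_map_nth)
  qed
  then have "fls_map of_rat (q_prod p) = (q_prod p :: complex fls)"
    unfolding q_prod_def
    by (simp add: coeff_hom.fls_map_prod[OF coeff_hom_of_rat] coeff_hom.fls_map_diff[OF coeff_hom_of_rat]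
      coeff_hom.fls_map_one[OF coeff_hom_of_rat])
  finally show ?thesis
    unfolding q_prod_def
    by (auto intro!: laurent_expansion_intros has_laurent_expansion_fps has_fps_expansion_exp)
qed

section \<open>Exponential sums over increasing tuples\<close>

lemma has_sum_product:
  fixes f :: "'a \<Rightarrow> complex" and g :: "'b \<Rightarrow> complex"
  assumes f: "(f has_sum a) A" "(\<lambda>x. norm (f x)) summable_on A"
    and g: "(g has_sum b) B" "(\<lambda>y. norm (g y)) summable_on B"
  shows "((\<lambda>(x, y). f x * g y) has_sum (a * b)) (A \<times> B)"
    and "(\<lambda>xy. norm (case xy of (x, y) \<Rightarrow> f x * g y)) summable_on (A \<times> B)"
proof -
  have "(\<lambda>xy. norm (f (fst xy)) * norm (g (snd xy))) summable_on (A \<times> B)"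
  proof (rule summable_on_SigmaI)
    fix x assume "x \<in> A"
    show "((\<lambda>y. norm (f (fst (x, y))) * norm (g (snd (x, y)))) has_sum
        norm (f x) * infsum (\<lambda>y. norm (g y)) B) B"
      using g(2) by (auto intro!: has_sum_cmult_right)
  next
    show "(\<lambda>x. norm (f x) * infsum (\<lambda>y. norm (g y)) B) summable_on A"
      using f(2) by (intro summable_on_cmult_left)
  qed auto
  then show abs: "(\<lambda>xy. norm (case xy of (x, y) \<Rightarrow> f x * g y)) summable_on (A \<times> B)"
    by (simp add: case_prod_unfold norm_mult)
  show "((\<lambda>(x, y). f x * g y) has_sum (a * b)) (A \<times> B)"
    by (rule has_sum_SigmaI[where g = "\<lambda>x. f x * b"])
      (use f(1) g(1) abs_summable_summable[OF abs] in \<open>auto intro!: has_sum_cmult_right has_sum_cmult_left\<close>)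
qed

definition tuples_above :: "nat \<Rightarrow> nat \<Rightarrow> nat list set" where
  "tuples_above n p = {j. length j = p \<and> sorted_wrt (<) j \<and> (\<forall>x\<in>set j. n < x)}"

definition exp_term :: "real \<Rightarrow> complex \<Rightarrow> nat list \<Rightarrow> complex" where
  "exp_term t z i = exp ((of_nat (sum_list i) + of_nat (length i) * of_real t) * z)"

lemma exp_term_append: "exp_term t z (i @ j) = exp_term t z i * exp_term t z j"
  by (simp add: exp_term_def exp_add[symmetric] algebra_simps)

lemma prod_exp_eq_exp_term:
  "(\<Prod>l<length i. exp ((of_nat (i ! l) + of_real t) * z)) = exp_term t z i"
  by (simp add: exp_sum[symmetric] exp_term_def sum_list_sum_nth sum.distrib
    sum_distrib_right[symmetric] atLeast0LessThan)

text \<open>A (p+1)-tuple above n is given by k = first entry - n - 1 and its tail lowered by k + 1,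
  which is an arbitrary p-tuple above n. Raising all p + 1 entries by k + 1 contributes
  e^{(p+1)(k+1)z}, a geometric series that converges because Re z < 0. Absolute convergence is
  carried along to allow the product of the two sums.\<close>

lemma exp_term_has_sum:
  assumes z: "Re z < 0"
  shows "(exp_term t z has_sum
      (exp ((of_nat p * (of_nat n + of_real t) + of_nat (\<Sum>{..p})) * z) *
       inverse (\<Prod>l=1..p. 1 - exp (of_nat l * z)))) (tuples_above n p) \<and>
    (\<lambda>j. norm (exp_term t z j)) summable_on tuples_above n p"
proof (induction p)
  case 0
  have "tuples_above n 0 = {[]}" by (auto simp: tuples_above_def)
  then show ?case by (simp add: exp_term_def has_sum_finiteI)
next
  case (Suc p)
  define S where "S = exp ((of_nat p * (of_nat n + of_real t) + of_nat (\<Sum>{..p})) * z) *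
       inverse (\<Prod>l=1..p. 1 - exp (of_nat l * z))"
  define Q where "Q = exp (of_nat (Suc p) * z)"
  define E where "E = exp ((of_nat n + of_real t) * z)"
  have Q: "norm Q < 1" using z by (auto simp: Q_def mult_pos_neg)
  then have Q1: "Q \<noteq> 1" by auto
  have "(\<lambda>k. Q * Q ^ k) sums (Q * (1 / (1 - Q)))"
    by (intro sums_mult geometric_sums Q)
  moreover have sm: "summable (\<lambda>k. norm (Q * Q ^ k))"
    using Q by (auto simp: norm_mult norm_power intro!: summable_mult summable_geometric)
  ultimately have geo: "((\<lambda>k. Q * Q ^ k) has_sum (Q * (1 / (1 - Q)))) UNIV"
    by (intro norm_summable_imp_has_sum)
  have geo_abs: "(\<lambda>k. norm (Q * Q ^ k)) summable_on UNIV"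
    by (rule norm_summable_imp_summable_on) (use sm in simp)
  note pr = has_sum_product[OF geo geo_abs Suc.IH[THEN conjunct1, folded S_def] Suc.IH[THEN conjunct2]]
  have pr1: "((\<lambda>xy. E * (case xy of (k, j) \<Rightarrow> Q * Q ^ k * exp_term t z j)) has_sum
      E * (Q * (1 / (1 - Q)) * S)) (UNIV \<times> tuples_above n p)"
    by (intro has_sum_cmult_right pr(1))
  have pr2: "(\<lambda>xy. norm (E * (case xy of (k, j) \<Rightarrow> Q * Q ^ k * exp_term t z j))) summable_on
      (UNIV \<times> tuples_above n p)"
    unfolding norm_mult by (intro summable_on_cmult_right pr(2)[unfolded norm_mult])
  \<comment> \<open>\<open>F\<close> builds the tuple from k and the lowered tail, and
    \<open>G\<close> takes it apart again.\<close>
  define F :: "nat \<times> nat list \<Rightarrow> nat list" where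
    "F = (\<lambda>(k, j). (n + Suc k) # map ((+) (Suc k)) j)"
  define G :: "nat list \<Rightarrow> nat \<times> nat list" where
    "G = (\<lambda>j. (hd j - Suc n, map (\<lambda>x. x - (hd j - n)) (tl j)))"
  have FG: "F (G j) = j" "G j \<in> UNIV \<times> tuples_above n p" if "j \<in> tuples_above n (Suc p)" for j
  proof -
    from that obtain a i where j: "j = a # i" "n < a" "\<forall>x\<in>set i. a < x" "sorted_wrt (<) i" "length i = p"
      by (cases j) (auto simp: tuples_above_def)
    have "Suc (a - Suc n) = a - n" using j by auto
    then show "F (G j) = j" using j by (auto simp: F_def G_def intro!: map_idI)
    have "sorted_wrt (\<lambda>x y. x - (a - n) < y - (a - n)) i"
      using j by (intro sorted_wrt_mono_rel[OF _ j(4)]) auto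
    then show "G j \<in> UNIV \<times> tuples_above n p"
      using j by (fastforce simp: tuples_above_def G_def sorted_wrt_map)
  qed
  have GF: "G (F kj) = kj" "F kj \<in> tuples_above n (Suc p)" if "kj \<in> UNIV \<times> tuples_above n p" for kj
    using that by (auto simp: F_def G_def tuples_above_def sorted_wrt_map intro!: map_idI)
  have val: "exp_term t z j = E * (case G j of (k, j) \<Rightarrow> Q * Q ^ k * exp_term t z j)"
    if "j \<in> tuples_above n (Suc p)" for j
  proof -
    obtain k i where ki: "G j = (k, i)" by (cases "G j")
    with FG[OF that] have j: "j = (n + Suc k) # map ((+) (Suc k)) i" and i: "length i = p"
      by (auto simp: F_def tuples_above_def)
    have "sum_list (map ((+) (Suc k)) i) = Suc k * length i + sum_list i"
      by (induction i) auto
    then have "exp_term t z j = exp ((of_nat n + of_real t) * z + of_nat (Suc k) * (of_nat (Suc p) * z) +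
        (of_nat (sum_list i) + of_nat (length i) * of_real t) * z)"
      using i by (simp add: exp_term_def j algebra_simps)
    also have "\<dots> = E * Q ^ Suc k * exp_term t z i"
      by (simp only: exp_add E_def Q_def exp_term_def exp_of_nat_mult)
    finally show ?thesis by (simp add: ki)
  qed
  have "E * (Q * (1 / (1 - Q)) * S) =
      exp ((of_nat (Suc p) * (of_nat n + of_real t) + of_nat (\<Sum>{..Suc p})) * z) *
       inverse (\<Prod>l=1..Suc p. 1 - exp (of_nat l * z))"
  proof -
    have "exp ((of_nat (Suc p) * (of_nat n + of_real t) + of_nat (\<Sum>{..Suc p})) * z) =
      exp ((of_nat n + of_real t) * z + of_nat (Suc p) * z +
        (of_nat p * (of_nat n + of_real t) + of_nat (\<Sum>{..p})) * z)"
      by (simp add: algebra_simps)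
    also have "\<dots> = E * Q * exp ((of_nat p * (of_nat n + of_real t) + of_nat (\<Sum>{..p})) * z)"
      by (simp only: exp_add E_def Q_def)
    finally have "exp ((of_nat (Suc p) * (of_nat n + of_real t) + of_nat (\<Sum>{..Suc p})) * z) =
      E * Q * exp ((of_nat p * (of_nat n + of_real t) + of_nat (\<Sum>{..p})) * z)" .
    moreover have "inverse (\<Prod>l=1..Suc p. 1 - exp (of_nat l * z)) =
        inverse (\<Prod>l=1..p. 1 - exp (of_nat l * z)) * (1 / (1 - Q))"
      by (simp add: Q_def field_simps)
    ultimately show ?thesis
      by (simp only: S_def mult_ac)
  qed
  moreover have "(exp_term t z has_sum E * (Q * (1 / (1 - Q)) * S)) (tuples_above n (Suc p)) \<longleftrightarrow>
      ((\<lambda>xy. E * (case xy of (k, j) \<Rightarrow> Q * Q ^ k * exp_term t z j)) has_sum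
      E * (Q * (1 / (1 - Q)) * S)) (UNIV \<times> tuples_above n p)"
    by (rule has_sum_reindex_bij_witness[of _ F G]) (assumption | rule FG GF val[symmetric] refl)+
  moreover have "(\<lambda>j. norm (exp_term t z j)) summable_on tuples_above n (Suc p) \<longleftrightarrow>
      (\<lambda>xy. norm (E * (case xy of (k, j) \<Rightarrow> Q * Q ^ k * exp_term t z j))) summable_on
        (UNIV \<times> tuples_above n p)"
    by (rule summable_on_reindex_bij_witness[of _ F G])
      (assumption | rule FG GF val[symmetric] refl arg_cong[where f = norm])+
  ultimately show ?case using pr1 pr2 by simp
qed

section \<open>The renormalized values\<close>

declare phi_minus.simps [simp del]

section \<open>Index tuples producing a given monomial\<close>

definition matching_tuples :: "nat list \<Rightarrow> nat multiset \<Rightarrow> nat list set" where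
  "matching_tuples \<alpha> m = {i \<in> index_tuples (length \<alpha>). xmono \<alpha> i = m}"

lemma xmono_Nil: "xmono [] i = {#}"
  by (simp add: xmono_def)

lemma xmono_Cons: "xmono (a # \<alpha>) (x # i) = replicate_mset a x + xmono \<alpha> i"
  unfolding xmono_def by (simp add: sum.lessThan_Suc_shift del: sum.lessThan_Suc)

lemma xmono_append:
  assumes "length \<alpha> = length i"
  shows "xmono (\<alpha> @ \<beta>) (i @ j) = xmono \<alpha> i + xmono \<beta> j"
  using assms by (induction \<alpha> i rule: list_induct2) (simp_all add: xmono_Cons xmono_Nil add.assoc)

lemma xmono_zeros: "xmono (replicate p 0) j = {#}"
  by (simp add: xmono_def)

text \<open>The last exponent is positive, so the last index occurs in m, and it bounds all the
  others.\<close>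

lemma finite_matching_tuples:
  assumes "left_weak \<gamma>"
  shows "finite (matching_tuples \<gamma> m)"
proof (cases \<gamma> rule: rev_cases)
  case Nil
  then show ?thesis
    by (auto simp: matching_tuples_def index_tuples_def)
next
  case (snoc \<gamma>' a)
  have "matching_tuples \<gamma> m \<subseteq> {i. set i \<subseteq> {..Max (set_mset m)} \<and> length i = length \<gamma>}"
  proof
    fix i assume i: "i \<in> matching_tuples \<gamma> m"
    then obtain i' x where ix: "i = i' @ [x]" "length i' = length \<gamma>'"
      by (cases i rule: rev_cases) (auto simp: matching_tuples_def index_tuples_def snoc)
    have "a > 0" using assms snoc by (simp add: left_weak_def)
    then have "x \<in># m"
      using i ix by (auto simp: matching_tuples_def snoc xmono_append xmono_Cons in_replicate_mset)
    then have "x \<le> Max (set_mset m)" by simp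
    moreover have "y \<le> x" if "y \<in> set i" for y
      using that i ix by (auto simp: matching_tuples_def index_tuples_def sorted_wrt_append)
    ultimately show "i \<in> {i. set i \<subseteq> {..Max (set_mset m)} \<and> length i = length \<gamma>}"
      using i by (force simp: matching_tuples_def index_tuples_def)
  qed
  then show ?thesis
    by (rule finite_subset) (rule finite_lists_length_eq, simp)
qed

text \<open>The last entry of a tuple is written \<open>last (0 # i)\<close>, so that it is \<open>0\<close> for the empty tuple.\<close>

lemma sorted_le_last: "sorted_wrt (<) i \<Longrightarrow> x \<in> set i \<Longrightarrow> x \<le> last (0 # i)" for i :: "nat list"
  by (induction i rule: rev_induct) (auto simp: sorted_wrt_append)

text \<open>Exponent 0 leaves no trace in the monomial, so the trailing indices are constrained only
  by the last index of the left weak part.\<close>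

lemma matching_tuples_append_zeros:
  "matching_tuples (\<gamma> @ replicate p 0) m =
    (\<Union>i\<in>matching_tuples \<gamma> m. (@) i ` tuples_above (last (0 # i)) p)"
proof (intro equalityI subsetI)
  fix k assume k: "k \<in> matching_tuples (\<gamma> @ replicate p 0) m"
  define i where "i = take (length \<gamma>) k"
  define j where "j = drop (length \<gamma>) k"
  have kij: "k = i @ j" by (simp add: i_def j_def)
  have len: "length i = length \<gamma>" "length j = p"
    using k by (auto simp: i_def j_def matching_tuples_def index_tuples_def)
  have "i \<in> matching_tuples \<gamma> m"
    using k len by (auto simp: matching_tuples_def index_tuples_def kij xmono_append xmono_zeros
      sorted_wrt_append)
  moreover have "j \<in> tuples_above (last (0 # i)) p"
    using k len by (auto simp: matching_tuples_def index_tuples_def tuples_above_def kij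
      sorted_wrt_append)
  ultimately show "k \<in> (\<Union>i\<in>matching_tuples \<gamma> m. (@) i ` tuples_above (last (0 # i)) p)"
    unfolding kij by blast
next
  fix k assume "k \<in> (\<Union>i\<in>matching_tuples \<gamma> m. (@) i ` tuples_above (last (0 # i)) p)"
  then obtain i j where kij: "k = i @ j" and i: "i \<in> matching_tuples \<gamma> m"
    and j: "j \<in> tuples_above (last (0 # i)) p"
    by blast
  have "\<forall>x\<in>set i. \<forall>y\<in>set j. x < y"
    using i j sorted_le_last[of i]
    by (fastforce simp: matching_tuples_def index_tuples_def tuples_above_def simp del: last.simps)
  moreover have "\<forall>y\<in>set j. 0 < y"
    using j by (auto simp: tuples_above_def)
  ultimately show "k \<in> matching_tuples (\<gamma> @ replicate p 0) m"
    using i j by (auto simp: kij matching_tuples_def index_tuples_def tuples_above_def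
      sorted_wrt_append xmono_append xmono_zeros)
qed

section \<open>Regularized functions with all weights equal to 1\<close>

definition unit_weights :: "nat list \<Rightarrow> (nat \<times> nat) list" where
  "unit_weights \<alpha> = zip \<alpha> (replicate (length \<alpha>) 1)"

lemma length_unit_weights [simp]: "length (unit_weights \<alpha>) = length \<alpha>"
  by (simp add: unit_weights_def)

lemma take_unit_weights: "take k (unit_weights \<alpha>) = unit_weights (take k \<alpha>)"
  by (simp add: unit_weights_def take_zip min.commute)

lemma drop_unit_weights: "drop k (unit_weights \<alpha>) = unit_weights (drop k \<alpha>)"
  by (simp add: unit_weights_def drop_zip)

lemma reg_fun_unit_weights:
  "reg_fun (unit_weights \<alpha>) m t z = infsum (exp_term t z) (matching_tuples \<alpha> m)"
proof -
  have "(\<Prod>l<length \<alpha>. exp ((of_nat (i ! l) + of_real t) * of_nat (snd (unit_weights \<alpha> ! l)) * z)) =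
      exp_term t z i" if "length i = length \<alpha>" for i
    unfolding prod_exp_eq_exp_term[symmetric] that
    by (rule prod.cong) (auto simp: unit_weights_def)
  moreover have "map fst (unit_weights \<alpha>) = \<alpha>" by (simp add: unit_weights_def)
  ultimately show ?thesis
    unfolding reg_fun_def matching_tuples_def
    by (intro infsum_cong_neutral) (auto simp: index_tuples_def)
qed

lemma reg_fun_zeros:
  assumes "left_weak \<gamma>" "Re z < 0"
  shows "reg_fun (unit_weights (\<gamma> @ replicate p 0)) m t z =
    (\<Sum>i\<in>matching_tuples \<gamma> m. exp_term t z i *
      (exp ((of_nat p * (of_nat (last (0 # i)) + of_real t) + of_nat (\<Sum>{..p})) * z) *
       inverse (\<Prod>l=1..p. 1 - exp (of_nat l * z))))"
  unfolding reg_fun_unit_weights matching_tuples_append_zeros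
proof (rule infsumI, rule sum_has_sum)
  show "finite (matching_tuples \<gamma> m)" using finite_matching_tuples[OF assms(1)] .
next
  fix i assume "i \<in> matching_tuples \<gamma> m"
  let ?S = "exp ((of_nat p * (of_nat (last (0 # i)) + of_real t) + of_nat (\<Sum>{..p})) * z) *
       inverse (\<Prod>l=1..p. 1 - exp (of_nat l * z))"
  have "((\<lambda>j. exp_term t z i * exp_term t z j) has_sum exp_term t z i * ?S)
      (tuples_above (last (0 # i)) p)"
    using exp_term_has_sum[OF assms(2)] by (intro has_sum_cmult_right) blast
  then show "(exp_term t z has_sum exp_term t z i * ?S) ((@) i ` tuples_above (last (0 # i)) p)"
    by (subst has_sum_reindex) (auto simp: o_def exp_term_append inj_on_def simp del: last.simps)
next
  fix i i' assume "i \<in> matching_tuples \<gamma> m" "i' \<in> matching_tuples \<gamma> m" "i \<noteq> i'"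
  then show "(@) i ` tuples_above (last (0 # i)) p \<inter> (@) i' ` tuples_above (last (0 # i')) p = {}"
    by (auto simp: matching_tuples_def index_tuples_def)
qed

text \<open>The contribution of the indices of the left weak part. It is regular in z with constant
  term 1, so it creates no poles and does not change the constant term of a regular factor.\<close>

definition base_factor :: "nat list \<Rightarrow> rat poly fls" where
  "base_factor i = poly_exp (of_nat (sum_list i) + of_nat (length i) * shift_poly 0)"

text \<open>The closed form of the convergent sum continues past Re z < 0, and its expansion at each
  t is the evaluation of one formal series over Q[t].\<close>

lemma phi_zeros:
  assumes "left_weak \<gamma>"
  shows "phi (unit_weights (\<gamma> @ replicate p 0)) m =
    (\<Sum>i\<in>matching_tuples \<gamma> m. base_factor i * zero_gf p (shift_poly 0 + of_nat (last (0 # i))))"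
proof (rule phi_eqI, rule is_laurent_expI)
  fix t z assume "Re z < 0"
  then show "reg_fun (unit_weights (\<gamma> @ replicate p 0)) m t z =
    (\<Sum>i\<in>matching_tuples \<gamma> m. exp_term t z i *
      (exp ((of_nat p * (of_nat (last (0 # i)) + of_real t) + of_nat (\<Sum>{..p})) * z) *
       inverse (\<Prod>l=1..p. 1 - exp (of_nat l * z))))"
    by (rule reg_fun_zeros[OF assms])
next
  fix t :: real
  note hom = coeff_hom.hom_add[OF coeff_hom_qpoly_eval] coeff_hom.hom_mult[OF coeff_hom_qpoly_eval]
    coeff_hom.hom_of_nat[OF coeff_hom_qpoly_eval] qpoly_eval_X
  have 1: "(\<lambda>z. exp_term t z i) has_laurent_expansion
      fls_map (\<lambda>p. qpoly_eval p t) (base_factor i)" for i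
    using poly_exp_expansion[of "of_nat (sum_list i) + of_nat (length i) * shift_poly 0" t]
    unfolding hom exp_term_def base_factor_def .
  have 2: "(\<lambda>z. exp ((of_nat p * (of_nat n + of_real t) + of_nat (\<Sum>{..p})) * z) *
       inverse (\<Prod>l=1..p. 1 - exp (of_nat l * z))) has_laurent_expansion
      fls_map (\<lambda>p. qpoly_eval p t) (zero_gf p (shift_poly 0 + of_nat n))" for n
    unfolding zero_gf_def coeff_hom.fls_map_mult[OF coeff_hom_qpoly_eval]
    using poly_exp_expansion[of "of_nat p * (shift_poly 0 + of_nat n) + of_nat (\<Sum>{..p})" t]
    unfolding hom by (intro has_laurent_expansion_mult q_prod_expansion) (simp add: add.commute)
  show "(\<lambda>z. \<Sum>i\<in>matching_tuples \<gamma> m. exp_term t z i *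
      (exp ((of_nat p * (of_nat (last (0 # i)) + of_real t) + of_nat (\<Sum>{..p})) * z) *
       inverse (\<Prod>l=1..p. 1 - exp (of_nat l * z)))) has_laurent_expansion
    fls_map (\<lambda>p. qpoly_eval p t)
     (\<Sum>i\<in>matching_tuples \<gamma> m. base_factor i * zero_gf p (shift_poly 0 + of_nat (last (0 # i))))"
    unfolding coeff_hom.fls_map_sum[OF coeff_hom_qpoly_eval]
      coeff_hom.fls_map_mult[OF coeff_hom_qpoly_eval]
    by (intro has_laurent_expansion_sum has_laurent_expansion_mult 1 2)
qed

section \<open>Counterterms of arbitrary weak compositions\<close>

lemma finite_mset_splits: "finite {(a, b). a + b = (m :: 'a multiset)}"
proof -
  have "finite {a. a \<subseteq># m}"
  proof (induction m)
    case (add x m)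
    have "{a. a \<subseteq># add_mset x m} \<subseteq> {a. a \<subseteq># m} \<union> add_mset x ` {a. a \<subseteq># m}"
    proof
      fix a assume a: "a \<in> {a. a \<subseteq># add_mset x m}"
      show "a \<in> {a. a \<subseteq># m} \<union> add_mset x ` {a. a \<subseteq># m}"
      proof (cases "x \<in># a")
        case True
        then obtain a' where "a = add_mset x a'" by (metis insert_DiffM)
        with a show ?thesis by auto
      next
        case False
        then have "count a y \<le> count m y" for y
          using a mset_subset_eq_count[of a "add_mset x m" y] by (cases "y = x") (auto simp: not_in_iff)
        then show ?thesis by (auto intro: mset_subset_eqI)
      qed
    qed
    then show ?case using add finite_subset by blast
  qed simp
  then have "finite ((\<lambda>a. (a, m - a)) ` {a. a \<subseteq># m})" by simp
  moreover have "{(a, b). a + b = m} \<subseteq> (\<lambda>a. (a, m - a)) ` {a. a \<subseteq># m}" by auto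
  ultimately show ?thesis by (rule finite_subset[rotated])
qed

lemma zs_mult_const:
  assumes "\<And>m. g m = (if m = {#} then c else 0)"
  shows "zs_mult f g m = f m * c"
proof -
  have "zs_mult f g m = (\<Sum>(a, b)\<in>{(m, {#})}. f a * g b)"
    unfolding zs_mult_def
    \<comment> \<open>Finiteness of the splittings is essential here, as a \<open>sum\<close> over
      an infinite set is 0 by convention.\<close>
    by (rule sum.mono_neutral_right) (use finite_mset_splits assms in \<open>auto split: if_splits\<close>)
  then show ?thesis by (simp add: assms)
qed

lemma phi_minus_eq:
  "phi_minus ab m = (if ab = [] then zs_one m else - polar (phi_E ab m))"
  by (subst phi_minus.simps) (simp add: phi_E_def)

lemma left_weak_drop: "left_weak \<gamma> \<Longrightarrow> left_weak (drop k \<gamma>)"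
  by (cases "k < length \<gamma>") (auto simp: left_weak_def)

text \<open>Packaged as a predicate to serve as induction hypothesis while \<open>phi_E\<close> is
  computed. Every weak composition has this shape, so it covers all counterterms with unit
  weights.\<close>

definition minus_formula :: "nat list \<Rightarrow> nat \<Rightarrow> bool" where
  "minus_formula \<gamma> p \<longleftrightarrow> (\<forall>m. phi_minus (unit_weights (\<gamma> @ replicate p 0)) m =
      (if \<gamma> = [] \<and> m = {#} then counterterm p else 0))"

text \<open>Cutting inside \<gamma> leaves a suffix that is not all zeros, whose counterterm
  vanishes. The other cuts split off j zeros. The bound j < length \<gamma> + p reflects that the
  prefix is nonempty, and j = 0 is the uncut term, inserted separately so that the empty word is
  covered too.\<close>

lemma phi_E_convolution:
  assumes lw: "left_weak \<gamma>"
    and IH: "\<And>\<delta> q. left_weak \<delta> \<Longrightarrow> length \<delta> + q < length \<gamma> + p \<Longrightarrow> minus_formula \<delta> q"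
  shows "phi_E (unit_weights (\<gamma> @ replicate p 0)) m =
    (\<Sum>j\<in>insert 0 {j. j \<le> p \<and> j < length \<gamma> + p}.
      phi (unit_weights (\<gamma> @ replicate (p - j) 0)) m * counterterm j)"
proof -
  let ?l = "length \<gamma>"
  let ?w = "unit_weights (\<gamma> @ replicate p 0)"
  let ?T = "\<lambda>j. phi (unit_weights (\<gamma> @ replicate (p - j) 0)) m * counterterm j"
  have "(\<Sum>k\<in>{1..<length ?w}. zs_mult (phi (take k ?w)) (phi_minus (drop k ?w)) m) =
      (\<Sum>k\<in>{max 1 ?l..<?l + p}. ?T (?l + p - k))"
  proof (rule sum.mono_neutral_cong_right)
    show "\<forall>k\<in>{1..<length ?w} - {max 1 ?l..<?l + p}.
        zs_mult (phi (take k ?w)) (phi_minus (drop k ?w)) m = 0"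
    proof
      fix k assume "k \<in> {1..<length ?w} - {max 1 ?l..<?l + p}"
      then have k: "1 \<le> k" "k < ?l" by auto
      have "minus_formula (drop k \<gamma>) p"
        using k by (intro IH left_weak_drop lw) auto
      \<comment> \<open>Both branches are 0; this is the shape that \<open>zs_mult_const\<close>
        expects.\<close>
      then have "phi_minus (drop k ?w) m' = (if m' = {#} then 0 else 0)" for m'
        using k by (simp add: minus_formula_def drop_unit_weights)
      then show "zs_mult (phi (take k ?w)) (phi_minus (drop k ?w)) m = 0"
        by (subst zs_mult_const[of _ 0]) auto
    qed
  next
    fix k assume k: "k \<in> {max 1 ?l..<?l + p}"
    have "minus_formula [] (?l + p - k)"
      using k by (intro IH) (auto simp: left_weak_def)
    moreover have "p - (k - ?l) = ?l + p - k" using k by auto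
    ultimately have "phi_minus (drop k ?w) m' = (if m' = {#} then counterterm (?l + p - k) else 0)" for m'
      using k by (simp add: minus_formula_def drop_unit_weights)
    then have "zs_mult (phi (take k ?w)) (phi_minus (drop k ?w)) m =
        phi (take k ?w) m * counterterm (?l + p - k)"
      by (rule zs_mult_const)
    moreover have "take k ?w = unit_weights (\<gamma> @ replicate (p - (?l + p - k)) 0)"
      using k by (auto simp: take_unit_weights min_def)
    ultimately show "zs_mult (phi (take k ?w)) (phi_minus (drop k ?w)) m = ?T (?l + p - k)"
      by simp
  qed auto
  also have "\<dots> = (\<Sum>j\<in>{j. 1 \<le> j \<and> j \<le> p \<and> j < ?l + p}. ?T j)"
    by (rule sum.reindex_bij_witness[of _ "\<lambda>j. ?l + p - j" "\<lambda>k. ?l + p - k"]) auto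
  finally have "phi_E ?w m = ?T 0 + (\<Sum>j\<in>{j. 1 \<le> j \<and> j \<le> p \<and> j < ?l + p}. ?T j)"
    by (simp add: phi_E_def counterterm_0)
  also have "\<dots> = (\<Sum>j\<in>insert 0 {j. 1 \<le> j \<and> j \<le> p \<and> j < ?l + p}. ?T j)"
    by simp
  also have "insert 0 {j. 1 \<le> j \<and> j \<le> p \<and> j < ?l + p} = insert 0 {j. j \<le> p \<and> j < ?l + p}"
    by auto
  finally show ?thesis .
qed

lemma matching_tuples_Nil: "matching_tuples [] m = (if m = {#} then {[]} else {})"
  by (auto simp: matching_tuples_def index_tuples_def xmono_Nil)

text \<open>With \<gamma> nonempty all p zeros may be split off, so the convolution is complete and
  becomes \<open>ren_gf\<close> for each tuple.\<close>

lemma phi_E_nonempty: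
  assumes lw: "left_weak \<gamma>" and ne: "\<gamma> \<noteq> []"
    and IH: "\<And>\<delta> q. left_weak \<delta> \<Longrightarrow> length \<delta> + q < length \<gamma> + p \<Longrightarrow> minus_formula \<delta> q"
  shows "phi_E (unit_weights (\<gamma> @ replicate p 0)) m =
    (\<Sum>i\<in>matching_tuples \<gamma> m. base_factor i * ren_gf p (shift_poly 0 + of_nat (last (0 # i))))"
proof -
  have "insert 0 {j. j \<le> p \<and> j < length \<gamma> + p} = {..p}" using ne by (cases \<gamma>) auto
  then have "phi_E (unit_weights (\<gamma> @ replicate p 0)) m =
    (\<Sum>j\<le>p. phi (unit_weights (\<gamma> @ replicate (p - j) 0)) m * counterterm j)"
    using phi_E_convolution[where m = m and p = p, OF lw IH] by simp
  also have "\<dots> = (\<Sum>j\<le>p. \<Sum>i\<in>matching_tuples \<gamma> m.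
      base_factor i * (zero_gf (p - j) (shift_poly 0 + of_nat (last (0 # i))) * counterterm j))"
    by (simp only: phi_zeros[OF lw] sum_distrib_right mult.assoc)
  also have "\<dots> = (\<Sum>i\<in>matching_tuples \<gamma> m.
      base_factor i * ren_gf p (shift_poly 0 + of_nat (last (0 # i))))"
    by (subst sum.swap) (simp only: ren_gf_def sum_distrib_left)
  finally show ?thesis .
qed

text \<open>Without \<gamma> the cut j = p is missing, which leaves exactly the sum in the recursion
  of \<open>counterterm\<close>.\<close>

lemma phi_E_zeros:
  assumes IH: "\<And>\<delta> q. left_weak \<delta> \<Longrightarrow> length \<delta> + q < p \<Longrightarrow> minus_formula \<delta> q" and "p > 0"
  shows "phi_E (unit_weights (replicate p 0)) m =
    (if m = {#} then \<Sum>j<p. zero_gf (p - j) (shift_poly 0) * counterterm j else 0)"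
proof -
  have lw: "left_weak []" by (simp add: left_weak_def)
  have "insert 0 {j. j \<le> p \<and> j < length ([] :: nat list) + p} = {..<p}" using assms by auto
  with phi_E_convolution[OF lw, of p m] IH phi_zeros[OF lw] show ?thesis
    by (simp add: matching_tuples_Nil base_factor_def poly_exp_0)
qed

lemma sum_regular:
  assumes "n < 0"
  shows "fls_nth (\<Sum>i\<in>A. base_factor i * ren_gf p (s i)) n = 0"
  by (simp add: fls_nth_sum) (intro sum.neutral ballI fls_regular_mult(1) assms,
      auto simp: base_factor_def poly_exp_nth ren_gf_regular)

text \<open>Strong induction on the length. For all zeros the claim is the recursion of
  \<open>counterterm\<close>; otherwise \<open>phi_E\<close> is built from regular series and has no
  polar part.\<close>

lemma minus_formula_holds: "left_weak \<gamma> \<Longrightarrow> minus_formula \<gamma> p"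
proof (induction "length \<gamma> + p" arbitrary: \<gamma> p rule: less_induct)
  case less
  show ?case
  proof (cases "\<gamma> = []")
    case True
    show ?thesis
    proof (cases "p = 0")
      case True
      with \<open>\<gamma> = []\<close> show ?thesis
        by (simp add: minus_formula_def phi_minus_eq unit_weights_def zs_one_def counterterm_0)
    next
      case False
      have "unit_weights (replicate p 0) \<noteq> []"
        using False by (metis length_0_conv length_replicate length_unit_weights)
      moreover have "polar 0 = 0" by (simp add: polar_def)
      ultimately show ?thesis
        using \<open>\<gamma> = []\<close> phi_E_zeros[of p] less False
        by (simp add: minus_formula_def phi_minus_eq counterterm.simps[of p])
    qed
  next
    case False
    have "unit_weights (\<gamma> @ replicate p 0) \<noteq> []"
      using False by (metis Nil_is_append_conv length_0_conv length_unit_weights)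
    moreover have "polar (phi_E (unit_weights (\<gamma> @ replicate p 0)) m) = 0" for m
      by (rule fls_eqI) (subst phi_E_nonempty[OF less(2) False less(1)],
         auto simp: polar_nth sum_regular simp del: last.simps)
    ultimately show ?thesis
      using False by (simp add: minus_formula_def phi_minus_eq)
  qed
qed

lemma Zren_zeros:
  assumes "left_weak \<gamma>"
  shows "Zren (unit_weights (\<gamma> @ replicate p 0)) m =
    (\<Sum>i\<in>matching_tuples \<gamma> m. pcompose (ren_poly p) (shift_poly 0 + of_nat (last (0 # i))))"
proof -
  let ?w = "unit_weights (\<gamma> @ replicate p 0)"
  have Z: "Zren ?w m = fls_nth (phi_E ?w m) 0"
    by (simp add: Zren_def phi_plus_def nonpolar_nth)
  consider "\<gamma> \<noteq> []" | "\<gamma> = []" "p = 0" | "\<gamma> = []" "p > 0" by auto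
  then show ?thesis
  proof cases
    case 1
    have "fls_nth (base_factor i * ren_gf p s) 0 = pcompose (ren_poly p) s" for i s
      by (subst fls_regular_mult(2)) (auto simp: base_factor_def poly_exp_nth ren_gf_regular ren_gf_nth_0)
    moreover have "phi_E ?w m = (\<Sum>i\<in>matching_tuples \<gamma> m.
        base_factor i * ren_gf p (shift_poly 0 + of_nat (last (0 # i))))"
      by (rule phi_E_nonempty[OF assms 1]) (rule minus_formula_holds)
    ultimately show ?thesis
      by (simp add: Z fls_nth_sum del: last.simps)
  next
    case 2
    then show ?thesis
      using phi_zeros[OF assms, of 0 m] unfolding Z
      by (simp add: phi_E_def matching_tuples_Nil zero_gf_0 base_factor_def poly_exp_0 ren_poly_0 pcompose_1)
  next
    case 3
    \<comment> \<open>For all zeros \<open>phi_E\<close> lacks the last term of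
      \<open>ren_gf\<close>. That term is purely polar, so the constant coefficient is still
      \<open>ren_poly p\<close>.\<close>
    have "ren_gf p (shift_poly 0) = (\<Sum>j<p. zero_gf (p - j) (shift_poly 0) * counterterm j) + counterterm p"
      by (simp add: ren_gf_def zero_gf_0 flip: lessThan_Suc_atMost)
    moreover have "fls_nth (counterterm p) 0 = 0"
      using 3 by (simp add: counterterm.simps[of p] polar_nth)
    ultimately have "fls_nth (\<Sum>j<p. zero_gf (p - j) (shift_poly 0) * counterterm j) 0 = ren_poly p"
      by (simp add: ren_poly_def)
    then show ?thesis
      using 3 phi_E_zeros[of p m] minus_formula_holds unfolding Z
      by (simp add: matching_tuples_Nil pcompose_idR)
  qed
qed

section \<open>Inserting zeros into a composition\<close>

definition insert_zero :: "nat \<Rightarrow> nat list \<Rightarrow> nat list" where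
  "insert_zero q \<gamma> = take q \<gamma> @ 0 # drop q \<gamma>"

lemma left_weak_insert_zero:
  assumes "left_weak \<gamma>" "q < length \<gamma>"
  shows "left_weak (insert_zero q \<gamma>)" "insert_zero q \<gamma> \<noteq> []"
  using assms by (auto simp: left_weak_def insert_zero_def)

lemma matching_tuples_insert_zero_iff:
  assumes "length A = q" "length (A @ B) = length \<gamma>"
  shows "A @ v # B \<in> matching_tuples (insert_zero q \<gamma>) m \<longleftrightarrow>
    A @ B \<in> matching_tuples \<gamma> m \<and> 0 < v \<and> (\<forall>x\<in>set A. x < v) \<and> (\<forall>x\<in>set B. v < x)"
proof -
  have "xmono (insert_zero q \<gamma>) (A @ v # B) = xmono (take q \<gamma>) A + xmono (drop q \<gamma>) B"
    using assms by (simp add: insert_zero_def xmono_append xmono_Cons)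
  also have "\<dots> = xmono (take q \<gamma> @ drop q \<gamma>) (A @ B)"
    using assms by (subst xmono_append) auto
  finally have "xmono (insert_zero q \<gamma>) (A @ v # B) = xmono \<gamma> (A @ B)" by simp
  moreover have "length (insert_zero q \<gamma>) = Suc (length \<gamma>)"
    using assms by (auto simp: insert_zero_def)
  ultimately show ?thesis
    using assms by (auto simp: matching_tuples_def index_tuples_def sorted_wrt_append)
qed

text \<open>Of the last i - 1 positive numbers below the last entry, length \<gamma> - 1 occur in i.
  Each of the others, collected in \<open>V i\<close>, can be inserted in exactly one place, giving
  a tuple for \<gamma> with a 0 inserted before its last entry. The last entry does not change, so
  any weight w in it may be carried along.\<close>

lemma sum_last_insert_zero:
  fixes w :: "nat \<Rightarrow> nat"
  assumes lw: "left_weak \<gamma>" and ne: "\<gamma> \<noteq> []"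
  shows "(\<Sum>i\<in>matching_tuples \<gamma> m. (last i - 1) * w (last i)) =
    (length \<gamma> - 1) * (\<Sum>i\<in>matching_tuples \<gamma> m. w (last i)) +
    (\<Sum>q<length \<gamma>. \<Sum>i\<in>matching_tuples (insert_zero q \<gamma>) m. w (last i))"
proof -
  define V where "V i = {1..<last i} - set i" for i :: "nat list"
  \<comment> \<open>\<open>f\<close> deletes the entry at position q, and \<open>g\<close> inserts v
    at its sorted position.\<close>
  define f :: "nat \<times> nat list \<Rightarrow> nat list \<times> nat" where
    "f = (\<lambda>(q, i). (take q i @ drop (Suc q) i, i ! q))"
  define g :: "nat list \<times> nat \<Rightarrow> nat \<times> nat list" where
    "g = (\<lambda>(i, v). (length (takeWhile (\<lambda>x. x < v) i),
       takeWhile (\<lambda>x. x < v) i @ v # dropWhile (\<lambda>x. x < v) i))"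
  let ?X = "Sigma (matching_tuples \<gamma> m) V"
  let ?Y = "Sigma {..<length \<gamma>} (\<lambda>q. matching_tuples (insert_zero q \<gamma>) m)"
  have cardV: "last i - 1 = (length \<gamma> - 1) + card (V i)" if "i \<in> matching_tuples \<gamma> m" for i
  proof -
    from that ne obtain i' x where i: "i = i' @ [x]" "length i = length \<gamma>" "sorted_wrt (<) i"
        "\<forall>y\<in>set i. 0 < y"
      by (cases i rule: rev_cases) (auto simp: matching_tuples_def index_tuples_def)
    have "distinct i" using i(3) by (simp add: strict_sorted_iff)
    then have "card (set i') = length \<gamma> - 1"
      using i(1,2) by (metis distinct_append distinct_card length_append_singleton diff_Suc_1)
    moreover have sub: "set i' \<subseteq> {1..<x}" using i by (auto simp: sorted_wrt_append Suc_le_eq)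
    moreover have "V i = {1..<x} - set i'" using i by (auto simp: V_def)
    ultimately show ?thesis
      using card_mono[OF _ sub] by (simp add: card_Diff_subset i(1))
  qed
  have Y: "g (f y) = y \<and> f y \<in> ?X \<and> last (fst (f y)) = last (snd y)" if "y \<in> ?Y" for y
  proof -
    obtain q i where y: "y = (q, i)" and q: "q < length \<gamma>"
      and i: "i \<in> matching_tuples (insert_zero q \<gamma>) m"
      using \<open>y \<in> ?Y\<close> by auto
    define A where "A = take q i"
    define v where "v = i ! q"
    define B where "B = drop (Suc q) i"
    have len: "length i = Suc (length \<gamma>)"
      using i q by (auto simp: matching_tuples_def index_tuples_def insert_zero_def)
    have iAvB: "i = A @ v # B"
      using len q by (simp add: A_def v_def B_def id_take_nth_drop)
    have lAB: "length A = q" "length (A @ B) = length \<gamma>" and "B \<noteq> []"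
      using len q by (auto simp: A_def B_def)
    note AB = matching_tuples_insert_zero_iff[OF lAB, of v m, folded iAvB, THEN iffD1, OF i]
    have tw: "takeWhile (\<lambda>x. x < v) (A @ B) = A" "dropWhile (\<lambda>x. x < v) (A @ B) = B"
      using AB \<open>B \<noteq> []\<close> by (cases B; auto simp: takeWhile_append dropWhile_append)+
    have fy: "f y = (A @ B, v)" by (simp add: f_def y A_def B_def v_def)
    have "v < last B" using AB \<open>B \<noteq> []\<close> by auto
    moreover have "v \<notin> set (A @ B)" using AB by auto
    ultimately have "f y \<in> ?X"
      using AB \<open>B \<noteq> []\<close> by (auto simp: fy V_def)
    moreover have "g (f y) = y"
      unfolding fy by (simp add: g_def tw y iAvB lAB)
    moreover have "last (fst (f y)) = last (snd y)"
      using \<open>B \<noteq> []\<close> unfolding fy by (simp add: y iAvB)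
    ultimately show ?thesis by blast
  qed
  have X: "f (g x) = x \<and> g x \<in> ?Y" if "x \<in> ?X" for x
  proof -
    obtain i v where x: "x = (i, v)" and i: "i \<in> matching_tuples \<gamma> m" and v: "v \<in> V i"
      using \<open>x \<in> ?X\<close> by auto
    define A where "A = takeWhile (\<lambda>x. x < v) i"
    define B where "B = dropWhile (\<lambda>x. x < v) i"
    have iAB: "i = A @ B" by (simp add: A_def B_def)
    have A: "\<forall>x\<in>set A. x < v" by (auto simp: A_def dest: set_takeWhileD)
    \<comment> \<open>The missing value v lies below the last entry, so it is never appended at the
      end and the position q stays below length \<gamma>.\<close>
    have "B \<noteq> []"
    proof
      assume "B = []"
      then have "last i \<in> set A"
        using i ne by (cases "A = []") (auto simp: iAB matching_tuples_def index_tuples_def)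
      with A v show False by (auto simp: V_def)
    qed
    have "\<not> hd B < v" using \<open>B \<noteq> []\<close> hd_dropWhile unfolding B_def by blast
    moreover have "sorted_wrt (<) B" "v \<notin> set B"
      using i v by (auto simp: iAB matching_tuples_def index_tuples_def sorted_wrt_append V_def)
    ultimately have B: "\<forall>x\<in>set B. v < x"
      by (cases B) auto
    have len: "length (A @ B) = length \<gamma>"
      using i by (auto simp: iAB matching_tuples_def index_tuples_def)
    have gx: "g x = (length A, A @ v # B)" by (simp add: g_def x A_def B_def)
    have "A @ v # B \<in> matching_tuples (insert_zero (length A) \<gamma>) m"
      using i v A B by (subst matching_tuples_insert_zero_iff[OF refl len]) (auto simp: iAB V_def)
    then have "g x \<in> ?Y" using len \<open>B \<noteq> []\<close> by (simp add: gx) (metis length_greater_0_conv less_add_same_cancel1)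
    moreover have "f (g x) = x" unfolding gx by (simp add: f_def x iAB)
    ultimately show ?thesis by blast
  qed
  have fin: "finite (matching_tuples (insert_zero q \<gamma>) m)" if "q < length \<gamma>" for q
    using that by (intro finite_matching_tuples left_weak_insert_zero lw)
  have "(\<Sum>q<length \<gamma>. \<Sum>i\<in>matching_tuples (insert_zero q \<gamma>) m. w (last i)) =
      (\<Sum>y\<in>?Y. w (last (snd y)))"
    using fin by (subst sum.Sigma) (auto simp: case_prod_unfold)
  also have "\<dots> = (\<Sum>x\<in>?X. w (last (fst x)))"
    by (rule sum.reindex_bij_witness[of _ g f]) (use X Y in auto)
  also have "\<dots> = (\<Sum>i\<in>matching_tuples \<gamma> m. \<Sum>v\<in>V i. w (last i))"
    using finite_matching_tuples[OF lw] by (subst sum.Sigma) (auto simp: case_prod_unfold V_def)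
  also have "\<dots> = (\<Sum>i\<in>matching_tuples \<gamma> m. card (V i) * w (last i))"
    by simp
  finally have "(\<Sum>q<length \<gamma>. \<Sum>i\<in>matching_tuples (insert_zero q \<gamma>) m. w (last i)) =
      (\<Sum>i\<in>matching_tuples \<gamma> m. card (V i) * w (last i))" .
  moreover have "(\<Sum>i\<in>matching_tuples \<gamma> m. (last i - 1) * w (last i)) =
      (\<Sum>i\<in>matching_tuples \<gamma> m. (length \<gamma> - 1) * w (last i) + card (V i) * w (last i))"
    by (rule sum.cong) (simp_all only: cardV add_mult_distrib)
  ultimately show ?thesis
    by (simp only: sum.distrib sum_distrib_left)
qed

section \<open>Series weighted by a binomial in the last index\<close>

definition smult_closed :: "('b \<Rightarrow> 'k::comm_ring_1 poly) set \<Rightarrow> bool" where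
  "smult_closed V \<longleftrightarrow> (\<lambda>m. 0) \<in> V \<and> (\<forall>f\<in>V. \<forall>g\<in>V. (\<lambda>m. f m + g m) \<in> V) \<and>
     (\<forall>c. \<forall>f\<in>V. (\<lambda>m. smult c (f m)) \<in> V)"

lemma smult_closed_add: "smult_closed V \<Longrightarrow> f \<in> V \<Longrightarrow> g \<in> V \<Longrightarrow> (\<lambda>m. f m + g m) \<in> V"
  by (simp add: smult_closed_def)

lemma smult_closed_smult: "smult_closed V \<Longrightarrow> f \<in> V \<Longrightarrow> (\<lambda>m. smult c (f m)) \<in> V"
  by (simp add: smult_closed_def)

lemma smult_closed_sum:
  assumes "smult_closed V" "\<And>x. x \<in> A \<Longrightarrow> F x \<in> V"
  shows "(\<lambda>m. \<Sum>x\<in>A. F x m) \<in> V"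
  using assms(2)
  by (induction A rule: infinite_finite_induct) (use assms(1) in \<open>auto simp: smult_closed_def\<close>)

text \<open>The upper argument is last i - 1 because indices start at 1, which makes t + 1 the base
  point of Newton's formula. For empty \<gamma> the value of \<open>last i\<close> is unspecified,
  which is harmless for j = 0.\<close>

definition binomial_series :: "nat list \<Rightarrow> nat \<Rightarrow> nat multiset \<Rightarrow> 'k::comm_ring_1 poly" where
  "binomial_series \<gamma> j m = (\<Sum>i\<in>matching_tuples \<gamma> m. of_nat ((last i - 1) choose j))"

lemma M_series_eq: "M_series \<gamma> m = of_nat (card (matching_tuples \<gamma> m))"
  by (simp add: M_series_def matching_tuples_def)

lemma binomial_series_0: "binomial_series \<gamma> 0 = M_series \<gamma>"
  by (rule ext) (simp add: binomial_series_def M_series_eq)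

lemma binomial_times_top: "n * (n choose j) = Suc j * (n choose Suc j) + j * (n choose j)"
proof (cases "j \<le> n")
  case True
  have "Suc j * (n choose Suc j) = (n - j) * (n choose j)"
    by (metis binomial_absorb_comp binomial_absorption mult.commute diff_Suc_1)
  with True show ?thesis by (simp add: add_mult_distrib[symmetric])
qed (simp add: binomial_eq_0)

text \<open>Apply \<open>sum_last_insert_zero\<close> with a binomial weight and expand the product
  with last i - 1 by \<open>binomial_times_top\<close>. All terms are kept additive so that the
  identity transfers from the natural numbers.\<close>

lemma binomial_series_Suc:
  assumes "left_weak \<gamma>" "\<gamma> \<noteq> []"
  shows "of_nat (Suc j) * binomial_series \<gamma> (Suc j) m + of_nat j * binomial_series \<gamma> j m =
    of_nat (length \<gamma> - 1) * binomial_series \<gamma> j m +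
    (\<Sum>q<length \<gamma>. binomial_series (insert_zero q \<gamma>) j m :: 'k::comm_ring_1 poly)"
proof -
  have "(\<Sum>i\<in>matching_tuples \<gamma> m. (last i - 1) * ((last i - 1) choose j)) =
    (length \<gamma> - 1) * (\<Sum>i\<in>matching_tuples \<gamma> m. (last i - 1) choose j) +
    (\<Sum>q<length \<gamma>. \<Sum>i\<in>matching_tuples (insert_zero q \<gamma>) m. (last i - 1) choose j)"
    by (rule sum_last_insert_zero[OF assms])
  then have "Suc j * (\<Sum>i\<in>matching_tuples \<gamma> m. (last i - 1) choose Suc j) +
      j * (\<Sum>i\<in>matching_tuples \<gamma> m. (last i - 1) choose j) =
    (length \<gamma> - 1) * (\<Sum>i\<in>matching_tuples \<gamma> m. (last i - 1) choose j) +
    (\<Sum>q<length \<gamma>. \<Sum>i\<in>matching_tuples (insert_zero q \<gamma>) m. (last i - 1) choose j)"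
    by (simp only: binomial_times_top sum.distrib sum_distrib_left)
  then have "(of_nat (Suc j * (\<Sum>i\<in>matching_tuples \<gamma> m. (last i - 1) choose Suc j) +
      j * (\<Sum>i\<in>matching_tuples \<gamma> m. (last i - 1) choose j)) :: 'k poly) =
    of_nat ((length \<gamma> - 1) * (\<Sum>i\<in>matching_tuples \<gamma> m. (last i - 1) choose j) +
    (\<Sum>q<length \<gamma>. \<Sum>i\<in>matching_tuples (insert_zero q \<gamma>) m. (last i - 1) choose j))"
    by (rule arg_cong)
  then show ?thesis
    unfolding of_nat_add of_nat_mult of_nat_sum binomial_series_def .
qed

lemma smult_of_nat: "smult (of_nat n) p = of_nat n * p"
  by (simp add: of_nat_poly)

text \<open>The previous identity is solved for the binomial of order j + 1, as j + 1 is a unit in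
  k; compositions with an inserted zero remain left weak, so the induction on j ranges over all
  \<gamma>. The module V is kept abstract because one application takes \<open>LWCQSym_t\<close> and
  another an auxiliary module.\<close>

lemma binomial_series_in_closed:
  fixes V :: "(nat multiset \<Rightarrow> 'k::comm_ring_1 poly) set"
  assumes unit: "\<forall>n::nat. n > 0 \<longrightarrow> (of_nat n :: 'k) dvd 1"
    and V: "smult_closed V" "\<And>\<gamma>. left_weak \<gamma> \<Longrightarrow> M_series \<gamma> \<in> V"
    and "left_weak \<gamma>" "\<gamma> \<noteq> []"
  shows "binomial_series \<gamma> j \<in> V"
  using assms(4,5)
proof (induction j arbitrary: \<gamma>)
  case 0
  then show ?case using V by (simp add: binomial_series_0)
next
  case (Suc j)
  have "(of_nat (Suc j) :: 'k) dvd 1" using unit by blast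
  then obtain u :: 'k where u: "1 = of_nat (Suc j) * u" by (elim dvdE)
  define c :: 'k where "c = of_nat (length \<gamma> - 1) - of_nat j"
  define T where "T m = smult c (binomial_series \<gamma> j m) +
      (\<Sum>q<length \<gamma>. binomial_series (insert_zero q \<gamma>) j m)" for m
  have "binomial_series \<gamma> j \<in> V" using Suc by blast
  moreover have "(\<lambda>m. \<Sum>q<length \<gamma>. binomial_series (insert_zero q \<gamma>) j m) \<in> V"
    using Suc left_weak_insert_zero by (intro smult_closed_sum[OF V(1)]) auto
  ultimately have "(\<lambda>m. smult u (T m)) \<in> V"
    unfolding T_def by (intro smult_closed_smult smult_closed_add V(1))
  moreover have "binomial_series \<gamma> (Suc j) m = smult u (T m)" for m
  proof -
    have "smult (of_nat (Suc j)) (binomial_series \<gamma> (Suc j) m) = T m"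
      using binomial_series_Suc[OF Suc.prems, of j m, where 'k = 'k]
      unfolding T_def c_def smult_diff_left smult_of_nat by (simp add: algebra_simps)
    then have "smult u (T m) = smult (u * of_nat (Suc j)) (binomial_series \<gamma> (Suc j) m)"
      by (metis smult_smult)
    also have "u * of_nat (Suc j) = 1" using u by (simp add: mult.commute)
    finally show ?thesis by simp
  qed
  ultimately show ?case by presburger
qed

section \<open>The embedding of Q into k\<close>

context
  assumes unit: "\<forall>n::nat. n > 0 \<longrightarrow> (of_nat n :: 'k::comm_ring_1) dvd 1"
begin

lemma of_int_unit:
  assumes "b > 0"
  obtains u :: 'k where "of_int b * u = 1"
proof -
  have "(of_nat (nat b) :: 'k) dvd 1" by (rule unit[rule_format]) (use assms in simp)
  then obtain u :: 'k where "1 = of_nat (nat b) * u" by (elim dvdE)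
  then show ?thesis using assms that[of u] by simp
qed

text \<open>Any representation of q as a fraction is allowed, not only the reduced one. Together
  with \<open>rat_to_unique\<close> this proves the homomorphism laws by clearing
  denominators.\<close>

lemma rat_to_mult_denom:
  assumes "q * of_int b = of_int a" "b > 0"
  shows "of_int b * rat_to q = (of_int a :: 'k)"
proof -
  obtain a0 b0 where q0: "quotient_of q = (a0, b0)" by (cases "quotient_of q")
  have b0: "b0 > 0" using q0 by (rule quotient_of_denom_pos)
  obtain u :: 'k where u: "of_int b0 * u = 1" using of_int_unit[OF b0] .
  have "(THE u. of_int b0 * u = (1::'k)) = u"
  proof (rule the_equality)
    fix v :: 'k assume "of_int b0 * v = 1"
    then show "v = u" using u by (metis mult.assoc mult.commute mult_1_left)
  qed (rule u)
  then have r: "rat_to q = of_int a0 * u" by (simp add: rat_to_def q0)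
  have "q * of_int b0 = of_int a0"
    using quotient_of_div[OF q0] b0 by simp
  then have "of_int (a * b0) = (of_int (a0 * b) :: rat)"
    using assms(1) by (metis mult.assoc mult.commute of_int_mult)
  then have "a * b0 = a0 * b" by (simp only: of_int_eq_iff)
  then have "of_int a * of_int b0 = (of_int a0 * of_int b :: 'k)"
    by (metis of_int_mult)
  then have "of_int b * rat_to q = of_int a * (of_int b0 * u)"
    unfolding r by (metis mult.assoc mult.commute)
  then show ?thesis by (simp add: u)
qed

lemma rat_to_unique:
  assumes "q * of_int b = of_int a" "b > 0" "of_int b * x = (of_int a :: 'k)"
  shows "x = rat_to q"
proof -
  obtain u :: 'k where u: "of_int b * u = 1" using of_int_unit[OF assms(2)] .
  have "of_int b * x = of_int b * rat_to q"
    using rat_to_mult_denom[OF assms(1,2)] assms(3) by simp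
  then show ?thesis using u by (metis mult.assoc mult.commute mult_1_left)
qed

lemma coeff_hom_rat_to: "coeff_hom (rat_to :: rat \<Rightarrow> 'k)"
proof
  fix x y :: rat
  obtain a b c d where xy: "x = of_int a / of_int b" "b > 0" "y = of_int c / of_int d" "d > 0"
    by (metis quotient_of_div quotient_of_denom_pos surj_pair)
  have bx: "of_int b * rat_to x = (of_int a :: 'k)" and dy: "of_int d * rat_to y = (of_int c :: 'k)"
    using xy by (auto intro!: rat_to_mult_denom)
  have "of_int (b * d) * (rat_to x + rat_to y) =
      of_int d * (of_int b * rat_to x) + of_int b * (of_int d * rat_to y :: 'k)"
    by (simp add: algebra_simps)
  then have "of_int (b * d) * (rat_to x + rat_to y) = (of_int (d * a + b * c) :: 'k)"
    by (simp add: bx dy)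
  then have "rat_to x + rat_to y = (rat_to (x + y) :: 'k)"
    by (rule rat_to_unique[rotated 2]) (use xy in \<open>auto simp: field_simps\<close>)
  then show "rat_to (x + y) = (rat_to x + rat_to y :: 'k)" ..
  have "of_int (b * d) * (rat_to x * rat_to y) =
      (of_int b * rat_to x) * (of_int d * rat_to y :: 'k)"
    by (simp add: algebra_simps)
  then have "of_int (b * d) * (rat_to x * rat_to y) = (of_int (a * c) :: 'k)"
    by (simp add: bx dy)
  then have "rat_to x * rat_to y = (rat_to (x * y) :: 'k)"
    by (rule rat_to_unique[rotated 2]) (use xy in \<open>auto simp: field_simps\<close>)
  then show "rat_to (x * y) = (rat_to x * rat_to y :: 'k)" ..
next
  show "rat_to 1 = (1 :: 'k)"
    by (rule rat_to_unique[symmetric, of _ 1 1]) auto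
qed

end

section \<open>Comparison of the two spans\<close>

text \<open>Both spaces are spans of this form, one with coefficients in k[t] acting by
  multiplication, the other with coefficients in k acting by \<open>smult\<close>; the common form
  gives the closure properties of both at once.\<close>

definition family_span ::
  "('c \<Rightarrow> 'v \<Rightarrow> 'v) \<Rightarrow> 'a set \<Rightarrow> ('a \<Rightarrow> 'b \<Rightarrow> 'v::comm_monoid_add) \<Rightarrow> ('b \<Rightarrow> 'v) set" where
  "family_span act S B = {f. \<exists>A c. finite A \<and> (\<forall>\<alpha>\<in>A. \<alpha> \<in> S) \<and> f = (\<lambda>m. \<Sum>\<alpha>\<in>A. act (c \<alpha>) (B \<alpha> m))}"

lemma LWCQSym_t_eq: "LWCQSym_t = family_span (*) {\<gamma>. left_weak \<gamma>} M_series"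
  by (simp add: LWCQSym_t_def family_span_def)

lemma RenQSym_eq: "RenQSym = family_span smult UNIV M_ren"
  by (simp add: RenQSym_def family_span_def)

context module
begin

lemma family_span_zero: "(\<lambda>m. 0) \<in> family_span scale S B"
  unfolding family_span_def by (rule CollectI, rule exI[of _ "{}"]) simp

lemma family_span_base: "\<alpha> \<in> S \<Longrightarrow> B \<alpha> \<in> family_span scale S B"
  unfolding family_span_def
  by (rule CollectI, rule exI[of _ "{\<alpha>}"], rule exI[of _ "\<lambda>_. 1"]) simp

lemma family_span_scale:
  assumes "f \<in> family_span scale S B"
  shows "(\<lambda>m. scale c (f m)) \<in> family_span scale S B"
proof -
  obtain A d where A: "finite A" "\<forall>\<alpha>\<in>A. \<alpha> \<in> S" "f = (\<lambda>m. \<Sum>\<alpha>\<in>A. scale (d \<alpha>) (B \<alpha> m))"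
    using assms unfolding family_span_def by blast
  then show ?thesis unfolding family_span_def
    by (intro CollectI exI[of _ A] exI[of _ "\<lambda>\<alpha>. c * d \<alpha>"]) (simp add: scale_sum_right)
qed

lemma family_span_add:
  assumes "f \<in> family_span scale S B" "g \<in> family_span scale S B"
  shows "(\<lambda>m. f m + g m) \<in> family_span scale S B"
proof -
  obtain A c where A: "finite A" "\<forall>\<alpha>\<in>A. \<alpha> \<in> S" "f = (\<lambda>m. \<Sum>\<alpha>\<in>A. scale (c \<alpha>) (B \<alpha> m))"
    using assms unfolding family_span_def by blast
  obtain A' c' where A': "finite A'" "\<forall>\<alpha>\<in>A'. \<alpha> \<in> S" "g = (\<lambda>m. \<Sum>\<alpha>\<in>A'. scale (c' \<alpha>) (B \<alpha> m))"
    using assms unfolding family_span_def by blast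
  define d where "d \<alpha> = (if \<alpha> \<in> A then c \<alpha> else 0) + (if \<alpha> \<in> A' then c' \<alpha> else 0)" for \<alpha>
  have "f m + g m = (\<Sum>\<alpha>\<in>A \<union> A'. scale (d \<alpha>) (B \<alpha> m))" for m
  proof -
    have "f m = (\<Sum>\<alpha>\<in>A \<union> A'. scale (if \<alpha> \<in> A then c \<alpha> else 0) (B \<alpha> m))"
      unfolding A(3) using A(1) A'(1) by (intro sum.mono_neutral_cong_left) auto
    moreover have "g m = (\<Sum>\<alpha>\<in>A \<union> A'. scale (if \<alpha> \<in> A' then c' \<alpha> else 0) (B \<alpha> m))"
      unfolding A'(3) using A(1) A'(1) by (intro sum.mono_neutral_cong_left) auto
    ultimately show ?thesis
      by (simp only: d_def scale_left_distrib sum.distrib)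
  qed
  then show ?thesis unfolding family_span_def
    by (intro CollectI exI[of _ "A \<union> A'"] exI[of _ d]) (use A A' in auto)
qed

end

interpretation smult_module: module "smult :: 'k::comm_ring_1 \<Rightarrow> 'k poly \<Rightarrow> 'k poly"
  by unfold_locales (auto simp: smult_add_left smult_add_right)

interpretation mult_module: module "(*) :: 'k::comm_ring_1 poly \<Rightarrow> 'k poly \<Rightarrow> 'k poly"
  by unfold_locales (auto simp: algebra_simps)

lemma smult_closed_RenQSym: "smult_closed (RenQSym :: (nat multiset \<Rightarrow> 'k::comm_ring_1 poly) set)"
  unfolding smult_closed_def RenQSym_eq
  using smult_module.family_span_zero smult_module.family_span_add smult_module.family_span_scale
  by blast

lemma LWCQSym_t_mult: "f \<in> LWCQSym_t \<Longrightarrow> (\<lambda>m. p * f m) \<in> LWCQSym_t"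
  unfolding LWCQSym_t_eq by (rule mult_module.family_span_scale)

lemma smult_closed_LWCQSym_t: "smult_closed (LWCQSym_t :: (nat multiset \<Rightarrow> 'k::comm_ring_1 poly) set)"
proof -
  have "(\<lambda>m. smult c (f m)) \<in> LWCQSym_t" if "f \<in> LWCQSym_t" for c :: 'k and f
    using LWCQSym_t_mult[OF that, of "[:c:]"] by simp
  then show ?thesis
    unfolding smult_closed_def LWCQSym_t_eq
    using mult_module.family_span_zero mult_module.family_span_add by blast
qed

lemma M_series_in_LWCQSym_t: "left_weak \<gamma> \<Longrightarrow> M_series \<gamma> \<in> LWCQSym_t"
  unfolding LWCQSym_t_eq by (rule mult_module.family_span_base) simp

lemma M_ren_in_RenQSym: "M_ren \<alpha> \<in> RenQSym"
  unfolding RenQSym_eq by (rule smult_module.family_span_base) simp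

section \<open>Newton expansion of the renormalized functions and its inversion\<close>

lemma left_weak_zeros_decomp:
  obtains \<gamma> p where "\<alpha> = \<gamma> @ replicate p 0" "left_weak \<gamma>"
proof -
  have "\<exists>\<gamma> p. \<alpha> = \<gamma> @ replicate p 0 \<and> left_weak \<gamma>"
  proof (induction \<alpha> rule: rev_induct)
    case Nil
    then show ?case by (simp add: left_weak_def)
  next
    case (snoc a \<alpha>)
    show ?case
    proof (cases "a = 0")
      case True
      from snoc obtain \<gamma> p where "\<alpha> = \<gamma> @ replicate p 0" "left_weak \<gamma>" by blast
      with True have "\<alpha> @ [a] = \<gamma> @ replicate (Suc p) 0"
        by (simp add: replicate_append_same)
      with \<open>left_weak \<gamma>\<close> show ?thesis by blast
    next
      case False
      then have "left_weak (\<alpha> @ [a])" by (simp add: left_weak_def)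
      then show ?thesis by (metis append_Nil2 replicate_0)
    qed
  qed
  then show ?thesis using that by blast
qed

text \<open>The coefficient of binom(n-1, j) in the Newton expansion of h_p(t+n) based at t +
  1.\<close>

definition newton_coeff :: "nat \<Rightarrow> nat \<Rightarrow> rat poly" where
  "newton_coeff p j = (-1) ^ j * pcompose (ren_poly (p - j)) (shift_poly (1 + of_nat j))"

lemma degree_newton_coeff: "degree (newton_coeff p j) = p - j" "newton_coeff p j \<noteq> 0"
proof -
  have h: "degree (pcompose (ren_poly (p - j)) (shift_poly (1 + of_nat j))) = p - j"
    "pcompose (ren_poly (p - j)) (shift_poly (1 + of_nat j)) \<noteq> 0"
    using degree_ren_poly[of "p - j"] by (auto simp: degree_pcompose pcompose_eq_0_iff)
  have "(-1) ^ j = (1 :: rat poly) \<or> (-1) ^ j = (-1 :: rat poly)"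
    by (cases "even j") auto
  then show "degree (newton_coeff p j) = p - j" "newton_coeff p j \<noteq> 0"
    unfolding newton_coeff_def using h by auto
qed

context
  assumes unit: "\<forall>n::nat. n > 0 \<longrightarrow> (of_nat n :: 'k::comm_ring_1) dvd 1"
begin

interpretation rat_hom: coeff_hom "map_poly (rat_to :: rat \<Rightarrow> 'k)"
  by (intro coeff_hom_map_poly coeff_hom_rat_to unit)

text \<open>Here the shift is 0 and only the empty monomial occurs, so the value is h_p(t)
  itself.\<close>

lemma M_ren_Nil: "(M_ren (replicate p 0) m :: 'k poly) = map_poly rat_to (ren_poly p) * M_series [] m"
proof -
  have "left_weak []" by (simp add: left_weak_def)
  from Zren_zeros[OF this, of p m] show ?thesis
    by (simp add: M_ren_def unit_weights_def M_series_eq matching_tuples_Nil pcompose_idR rat_hom.hom_zero)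
qed

lemma M_ren_zeros:
  assumes "left_weak \<gamma>" "\<gamma> \<noteq> []"
  shows "(M_ren (\<gamma> @ replicate p 0) m :: 'k poly) =
    (\<Sum>j\<le>p. map_poly rat_to (newton_coeff p j) * binomial_series \<gamma> j m)"
proof -
  have "pcompose (ren_poly p) (shift_poly 0 + of_nat (last (0 # i))) =
      (\<Sum>j\<le>p. newton_coeff p j * of_nat ((last i - 1) choose j))"
    if "i \<in> matching_tuples \<gamma> m" for i
  proof -
    have "i \<noteq> []" "\<forall>x\<in>set i. 0 < x"
      using that assms by (auto simp: matching_tuples_def index_tuples_def)
    then have "i \<noteq> []" "0 < last i" by auto
    \<comment> \<open>The last index is positive, so the natural subtraction is exact.\<close>
    then have 1: "shift_poly 0 + of_nat (last (0 # i)) = shift_poly 1 + of_nat (last i - 1)"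
      by (simp add: of_nat_poly)
    have 2: "shift_poly (1 + of_nat j) = shift_poly 1 + of_nat j" for j
      by (simp add: of_nat_poly)
    show ?thesis
      unfolding 1 ren_poly_newton[of p "shift_poly 1" "last i - 1"] newton_coeff_def 2
      by (intro sum.cong refl) (simp only: mult_ac)
  qed
  then have "Zren (unit_weights (\<gamma> @ replicate p 0)) m =
      (\<Sum>i\<in>matching_tuples \<gamma> m. \<Sum>j\<le>p. newton_coeff p j * of_nat ((last i - 1) choose j))"
    unfolding Zren_zeros[OF assms(1)] by (rule sum.cong[OF refl])
  also have "\<dots> = (\<Sum>j\<le>p. newton_coeff p j * (\<Sum>i\<in>matching_tuples \<gamma> m. of_nat ((last i - 1) choose j)))"
    by (subst sum.swap) (simp only: sum_distrib_left)
  finally have "(M_ren (\<gamma> @ replicate p 0) m :: 'k poly) = map_poly rat_to (\<Sum>j\<le>p. newton_coeff p j *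
      (\<Sum>i\<in>matching_tuples \<gamma> m. of_nat ((last i - 1) choose j)))"
    unfolding M_ren_def by (simp only: unit_weights_def)
  then show ?thesis
    by (simp only: rat_hom.hom_sum rat_hom.hom_mult rat_hom.hom_of_nat binomial_series_def)
qed

lemma M_ren_in_LWCQSym_t: "(M_ren \<alpha> :: nat multiset \<Rightarrow> 'k poly) \<in> LWCQSym_t"
proof -
  obtain \<gamma> p where \<alpha>: "\<alpha> = \<gamma> @ replicate p 0" and lw: "left_weak \<gamma>"
    by (rule left_weak_zeros_decomp)
  show ?thesis
  proof (cases "\<gamma> = []")
    case True
    then have "(M_ren \<alpha> :: nat multiset \<Rightarrow> 'k poly) = (\<lambda>m. map_poly rat_to (ren_poly p) * M_series [] m)"
      by (simp add: fun_eq_iff \<alpha> M_ren_Nil)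
    then show ?thesis
      using lw True by (simp add: LWCQSym_t_mult M_series_in_LWCQSym_t)
  next
    case False
    have "(M_ren \<alpha> :: nat multiset \<Rightarrow> 'k poly) =
        (\<lambda>m. \<Sum>j\<le>p. map_poly rat_to (newton_coeff p j) * binomial_series \<gamma> j m)"
      unfolding \<alpha> by (rule ext) (rule M_ren_zeros[OF lw False])
    also have "\<dots> \<in> LWCQSym_t"
      by (intro smult_closed_sum smult_closed_LWCQSym_t LWCQSym_t_mult
        binomial_series_in_closed unit M_series_in_LWCQSym_t lw False)
    finally show ?thesis .
  qed
qed

text \<open>The leading coefficient is a nonzero rational, and \<open>rat_to\<close> carries its
  inverse to an inverse in k.\<close>

lemma map_poly_rat_to_lead_unit:
  assumes "degree f = p" "f \<noteq> 0"
  obtains u :: 'k where "coeff (map_poly rat_to f) p * u = 1"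
proof -
  interpret coeff_hom "rat_to :: rat \<Rightarrow> 'k" by (rule coeff_hom_rat_to[OF unit])
  have "coeff f p * inverse (coeff f p) = 1"
    using assms by (metis leading_coeff_0_iff right_inverse)
  then have "rat_to (coeff f p) * rat_to (inverse (coeff f p)) = (1 :: 'k)"
    by (simp flip: hom_mult add: hom_one)
  then show ?thesis using that by (simp add: coeff_map_poly hom_zero)
qed

text \<open>Induction on a degree bound in t, for all \<gamma> at once. The degree p part of g is
  removed with the renormalized function of \<gamma> followed by p zeros, and what remains has
  smaller degree. The disjunct g = 0 makes the bound 0 meaningful.\<close>

lemma poly_times_M_series_in_RenQSym:
  fixes g :: "'k poly"
  assumes "left_weak \<gamma>" "g = 0 \<or> degree g < p"
  shows "(\<lambda>m. g * M_series \<gamma> m) \<in> RenQSym"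
  using assms
proof (induction p arbitrary: \<gamma> g)
  case 0
  then show ?case using smult_closed_RenQSym[where 'k = 'k] by (simp add: smult_closed_def)
next
  case (Suc p)
  \<comment> \<open>By the induction hypothesis V contains every left weak series, hence also every
    binomial series of a nonempty left weak composition.\<close>
  define V :: "(nat multiset \<Rightarrow> 'k poly) set" where
    "V = {f. \<forall>g. g = 0 \<or> degree g < p \<longrightarrow> (\<lambda>m. g * f m) \<in> RenQSym}"
  have "smult_closed V"
    using smult_closed_RenQSym[where 'k = 'k] unfolding smult_closed_def V_def
    by (auto simp: distrib_left)
  moreover have "M_series \<delta> \<in> V" if "left_weak \<delta>" for \<delta>
    using Suc.IH that unfolding V_def by blast
  ultimately have binom: "binomial_series \<delta> j \<in> V" if "left_weak \<delta>" "\<delta> \<noteq> []" for \<delta> j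
    using that by (intro binomial_series_in_closed unit)
  \<comment> \<open>Modulo lower degrees in \<open>t\<close>, the renormalized function of \<open>\<gamma>\<close> followed by \<open>p\<close> zeros is
    a polynomial of degree \<open>p\<close> with invertible leading coefficient times the series of \<open>\<gamma>\<close>.\<close>
  obtain f where f: "degree f = p" "f \<noteq> 0"
    and top: "(\<lambda>m. map_poly rat_to f * M_series \<gamma> m :: 'k poly) \<in> RenQSym"
  proof (cases "\<gamma> = []")
    case True
    have "(\<lambda>m. map_poly rat_to (ren_poly p) * M_series \<gamma> m :: 'k poly) = M_ren (replicate p 0)"
      by (simp add: fun_eq_iff True M_ren_Nil)
    moreover have "(M_ren (replicate p 0) :: nat multiset \<Rightarrow> 'k poly) \<in> RenQSym"
      by (rule M_ren_in_RenQSym)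
    ultimately show ?thesis
      using that[of "ren_poly p"] degree_ren_poly by simp
  next
    case False
    have "(\<lambda>m. map_poly rat_to (newton_coeff p j) * binomial_series \<gamma> j m :: 'k poly) \<in> RenQSym"
      if "j \<in> {1..p}" for j
    proof -
      \<comment> \<open>The Newton coefficient has degree p - j, which is below p as j is at least
        1; the induction hypothesis thus absorbs every term but the top one.\<close>
      have "degree (map_poly (rat_to :: rat \<Rightarrow> 'k) (newton_coeff p j)) < p"
        using that degree_newton_coeff[of p j]
        by (intro le_less_trans[OF map_poly_degree_leq]) auto
      then show ?thesis
        using binom[OF Suc.prems(1) False, of j] by (simp add: V_def)
    qed
    then have "(\<lambda>m. \<Sum>j\<in>{1..p}. map_poly rat_to (newton_coeff p j) * binomial_series \<gamma> j m :: 'k poly) \<in> RenQSym"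
      by (rule smult_closed_sum[OF smult_closed_RenQSym])
    then have "(\<lambda>m. M_ren (\<gamma> @ replicate p 0) m + smult (-1)
        (\<Sum>j\<in>{1..p}. map_poly rat_to (newton_coeff p j) * binomial_series \<gamma> j m) :: 'k poly) \<in> RenQSym"
      by (intro smult_closed_add[where f = "M_ren (\<gamma> @ replicate p 0)"] smult_closed_smult smult_closed_RenQSym M_ren_in_RenQSym)
    moreover have "M_ren (\<gamma> @ replicate p 0) m + smult (-1)
        (\<Sum>j\<in>{1..p}. map_poly rat_to (newton_coeff p j) * binomial_series \<gamma> j m) =
        (map_poly rat_to (newton_coeff p 0) * M_series \<gamma> m :: 'k poly)" for m
      unfolding M_ren_zeros[OF Suc.prems(1) False] atMost_atLeast0
      by (simp add: sum.atLeast_Suc_atMost binomial_series_0)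
    ultimately show ?thesis
      using that[of "newton_coeff p 0"] degree_newton_coeff[of p 0] by simp
  qed
  obtain u :: 'k where u: "coeff (map_poly rat_to f) p * u = 1"
    using map_poly_rat_to_lead_unit[OF f] .
  \<comment> \<open>This scalar makes the coefficients of degree p cancel in
    \<open>r\<close>.\<close>
  define c where "c = coeff g p * u"
  define r where "r = g - smult c (map_poly rat_to f)"
  have "coeff r p = 0" by (simp add: r_def c_def mult.assoc mult.commute[of u] u)
  moreover have "degree r \<le> p"
    unfolding r_def using Suc.prems(2) f(1)
    by (intro degree_diff_le order.trans[OF degree_smult_le] order.trans[OF map_poly_degree_leq]) auto
  ultimately have "r = 0 \<or> degree r < p"
    by (metis leading_coeff_0_iff le_neq_implies_less)
  then have "(\<lambda>m. r * M_series \<gamma> m) \<in> RenQSym"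
    using Suc by blast
  with top have "(\<lambda>m. smult c (map_poly rat_to f * M_series \<gamma> m) + r * M_series \<gamma> m) \<in> RenQSym"
    by (intro smult_closed_add[OF smult_closed_RenQSym] smult_closed_smult[OF smult_closed_RenQSym])
  then show ?case by (simp add: r_def algebra_simps)
qed

end

theorem theorem5p7:
  assumes "\<forall>n::nat. n > 0 \<longrightarrow> (of_nat n :: 'k::comm_ring_1) dvd 1"
  shows "(LWCQSym_t :: (nat multiset \<Rightarrow> 'k poly) set) = RenQSym"
proof
  show "(LWCQSym_t :: (nat multiset \<Rightarrow> 'k poly) set) \<subseteq> RenQSym"
  proof
    fix f :: "nat multiset \<Rightarrow> 'k poly"
    assume "f \<in> LWCQSym_t"
    then obtain A c where A: "\<forall>\<gamma>\<in>A. left_weak \<gamma>" and f: "f = (\<lambda>m. \<Sum>\<gamma>\<in>A. c \<gamma> * M_series \<gamma> m)"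
      unfolding LWCQSym_t_def by blast
    show "f \<in> RenQSym"
      unfolding f by (rule smult_closed_sum[OF smult_closed_RenQSym],
        rule poly_times_M_series_in_RenQSym[OF assms]) (use A in auto)
  qed
  show "(RenQSym :: (nat multiset \<Rightarrow> 'k poly) set) \<subseteq> LWCQSym_t"
  proof
    fix f :: "nat multiset \<Rightarrow> 'k poly"
    assume "f \<in> RenQSym"
    then obtain A c where f: "f = (\<lambda>m. \<Sum>\<alpha>\<in>A. smult (c \<alpha>) (M_ren \<alpha> m))"
      unfolding RenQSym_def by blast
    show "f \<in> LWCQSym_t"
      unfolding f by (intro smult_closed_sum smult_closed_LWCQSym_t smult_closed_smult
        M_ren_in_LWCQSym_t assms)
  qed
qed

end
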